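(* Let $J$ be an ideal of $\mathbf{k}[a,x]$, let $\mathcal{Q}\subset\mathbf{k}[a]$ be a prime ideal, and let $\prec$ be a monomial order on the terms $x^\alpha$ which is a well order. Let $G$ be a minimal Gröbner basis of $\tilde{J}=J+\mathbf{k}[a,x]\cdot\mathcal{Q}$ with respect to $<$. Take $\mathcal{G}=G\smallsetminus\mathcal{Q}$ and let $h$ be the product of the $\mathrm{lc}_\prec(g)$ for $g\in\mathcal{G}$. Then for any prime ideal $\mathcal{P}\in V(\mathcal{Q})\smallsetminus V(h)$, $(\mathcal{G})_{\mathcal{P}}$ is a $\prec$-Gröbner basis of $(J)_{\mathcal{P}}$.
   Context: $\mathbf{k}$ is a field, $a=(a^1,\dots,a^m)$ are parameters, $x=(x_1,\dots,x_n)$ are the main variables. A monomial order is a total order on terms compatible with products. Fix a monomial order $<_0$ on the terms $a^\gamma$ ($\gamma\in\mathbb{N}^m$) which is a well order. The order $<$ on terms $x^\alpha a^\gamma$ is: $x^\alpha a^\gamma<x^{\alpha'}a^{\gamma'}$ iff $x^\alpha\prec x^{\alpha'}$, or $x^\alpha=x^{\alpha'}$ and $a^\gamma<_0a^{\gamma'}$; it is a well order. A Gröbner basis is minimal if no leading exponent of one of its elements lies in $e+\mathbb{N}^{n+m}$ where $e$ is the leading exponent of another of its elements. For $0\ne f\in\mathbf{k}[a,x]=\mathbf{k}[a][x]$, $f=\sum_\alpha c_\alpha x^\alpha$ with $c_\alpha\in\mathbf{k}[a]$, $\exp_\prec(f)=\max_\prec\{\alpha:c_\alpha\neq0\}$ and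 $\mathrm{lc}_\prec(f)=c_{\exp_\prec(f)}\in\mathbf{k}[a]$. $V(\mathcal{I})$ is the set of prime ideals of $\mathbf{k}[a]$ containing $\mathcal{I}$, and $V(h)=V(h\,\mathbf{k}[a])$. For $\mathcal{P}\in\mathrm{Spec}(\mathbf{k}[a])$, $\mathcal{F}(\mathcal{P})=\mathrm{Frac}(\mathbf{k}[a]/\mathcal{P})$, and $f\mapsto(f)_{\mathcal{P}}$ is the coefficientwise map $\mathbf{k}[a][x]\to\mathcal{F}(\mathcal{P})[x]$; $(\mathcal{G})_{\mathcal{P}}=\{(g)_{\mathcal{P}}:g\in\mathcal{G}\}$, and $(J)_{\mathcal{P}}$ is the ideal of $\mathcal{F}(\mathcal{P})[x]$ generated by all $(f)_{\mathcal{P}}$, $f\in J$. *)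

theory Defs
  imports
    "HOL-Algebra.QuotRing"
    "HOL-Library.Poly_Mapping"
    "HOL-Library.Product_Plus"
begin

text \<open>
  An exponent in \<open>\<nat>\<^sup>n\<close> is an element of \<^typ>\<open>'n \<Rightarrow>\<^sub>0 nat\<close> with \<open>'n\<close> finite of cardinality \<open>n\<close>
  (so the sum defining the product is finite). A polynomial is its coefficient
  function, so that \<open>\<k>[a][x]\<close> is the construction applied twice. The type of polynomials
  \<open>_ \<Rightarrow>\<^sub>0 _\<close> is not used for this, since the residue field of a prime ideal is not a type.
\<close>

definition mpoly_ring :: "('a, 'b) ring_scheme \<Rightarrow> (('n::finite \<Rightarrow>\<^sub>0 nat) \<Rightarrow> 'a) ring" where
  "mpoly_ring R =
    \<lparr> carrier = {f. (\<forall>\<alpha>. f \<alpha> \<in> carrier R) \<and> finite {\<alpha>. f \<alpha> \<noteq> \<zero>\<^bsub>R\<^esub>}},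
      mult = (\<lambda>f g \<gamma>. \<Oplus>\<^bsub>R\<^esub>p \<in> {p. fst p + snd p = \<gamma>}. f (fst p) \<otimes>\<^bsub>R\<^esub> g (snd p)),
      one = (\<lambda>\<alpha>. if \<alpha> = 0 then \<one>\<^bsub>R\<^esub> else \<zero>\<^bsub>R\<^esub>),
      zero = (\<lambda>\<alpha>. \<zero>\<^bsub>R\<^esub>),
      add = (\<lambda>f g \<alpha>. f \<alpha> \<oplus>\<^bsub>R\<^esub> g \<alpha>) \<rparr>"

definition mpoly_const :: "('a, 'b) ring_scheme \<Rightarrow> 'a \<Rightarrow> ('n::finite \<Rightarrow>\<^sub>0 nat) \<Rightarrow> 'a" where
  "mpoly_const R c = (\<lambda>\<alpha>. if \<alpha> = 0 then c else \<zero>\<^bsub>R\<^esub>)"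

definition mpoly_supp ::
  "('a, 'b) ring_scheme \<Rightarrow> (('n::finite \<Rightarrow>\<^sub>0 nat) \<Rightarrow> 'a) \<Rightarrow> ('n \<Rightarrow>\<^sub>0 nat) set" where
  "mpoly_supp R f = {\<alpha>. f \<alpha> \<noteq> \<zero>\<^bsub>R\<^esub>}"

text \<open>For \<open>f \<in> \<k>[a][x]\<close>, the pairs \<open>(\<alpha>, \<gamma>)\<close> such that the term \<open>x\<^sup>\<alpha> a\<^sup>\<gamma>\<close> occurs in \<open>f\<close>.\<close>

definition mpoly_supp2 ::
  "('k, 'b) ring_scheme \<Rightarrow> (('n::finite \<Rightarrow>\<^sub>0 nat) \<Rightarrow> ('m::finite \<Rightarrow>\<^sub>0 nat) \<Rightarrow> 'k)
    \<Rightarrow> (('n \<Rightarrow>\<^sub>0 nat) \<times> ('m \<Rightarrow>\<^sub>0 nat)) set" where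
  "mpoly_supp2 K f = {(\<alpha>, \<gamma>). f \<alpha> \<gamma> \<noteq> \<zero>\<^bsub>K\<^esub>}"

text \<open>All orders are strict: \<open>prec \<alpha> \<beta>\<close> means that \<open>\<alpha>\<close> is strictly smaller than \<open>\<beta>\<close>.\<close>

definition monomial_order :: "('e::comm_monoid_add \<Rightarrow> 'e \<Rightarrow> bool) \<Rightarrow> bool" where
  "monomial_order prec \<longleftrightarrow>
    irreflp prec \<and> transp prec \<and> totalp prec \<and>
    (\<forall>\<alpha> \<beta> \<gamma>. prec \<alpha> \<beta> \<longrightarrow> prec (\<alpha> + \<gamma>) (\<beta> + \<gamma>))"

definition block_order ::
  "('e \<Rightarrow> 'e \<Rightarrow> bool) \<Rightarrow> ('d \<Rightarrow> 'd \<Rightarrow> bool) \<Rightarrow> 'e \<times> 'd \<Rightarrow> 'e \<times> 'd \<Rightarrow> bool" where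
  "block_order prec prec0 = (\<lambda>(\<alpha>, \<gamma>) (\<alpha>', \<gamma>'). prec \<alpha> \<alpha>' \<or> \<alpha> = \<alpha>' \<and> prec0 \<gamma> \<gamma>')"

definition max_exp :: "('e \<Rightarrow> 'e \<Rightarrow> bool) \<Rightarrow> 'e set \<Rightarrow> 'e" where
  "max_exp prec S = (THE \<alpha>. \<alpha> \<in> S \<and> (\<forall>\<beta>\<in>S. \<beta> \<noteq> \<alpha> \<longrightarrow> prec \<beta> \<alpha>))"

definition lead_coef ::
  "('a, 'b) ring_scheme \<Rightarrow> (('n::finite \<Rightarrow>\<^sub>0 nat) \<Rightarrow> ('n \<Rightarrow>\<^sub>0 nat) \<Rightarrow> bool)
    \<Rightarrow> (('n \<Rightarrow>\<^sub>0 nat) \<Rightarrow> 'a) \<Rightarrow> 'a" where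
  "lead_coef R prec f = f (max_exp prec (mpoly_supp R f))"

text \<open>
  The function \<open>supp\<close> gives the exponents of a polynomial in the ring \<open>A\<close>. It is a parameter because
  \<open>\<k>[a][x]\<close> is considered with exponents in both groups of variables, and a polynomial ring
  over a residue field with exponents in the main variables only. The equation says that the
  leading exponents of the nonzero elements of \<open>J\<close> are the union of the \<open>exp(g) + \<nat>\<^sup>N\<close> for \<open>g \<in> G\<close>.
  The zero polynomial has no leading exponent, so it is not allowed in a Groebner basis.
\<close>

definition groebner_basis ::
  "('p, 'c) ring_scheme \<Rightarrow> ('p \<Rightarrow> 'e::comm_monoid_add set) \<Rightarrow> ('e \<Rightarrow> 'e \<Rightarrow> bool)
    \<Rightarrow> 'p set \<Rightarrow> 'p set \<Rightarrow> bool" where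
  "groebner_basis A supp prec G J \<longleftrightarrow>
    finite G \<and> G \<subseteq> J - {\<zero>\<^bsub>A\<^esub>} \<and>
    {max_exp prec (supp f) | f. f \<in> J - {\<zero>\<^bsub>A\<^esub>}} =
      (\<Union>g\<in>G. {max_exp prec (supp g) + \<beta> | \<beta>. True})"

definition minimal_groebner_basis ::
  "('p, 'c) ring_scheme \<Rightarrow> ('p \<Rightarrow> 'e::comm_monoid_add set) \<Rightarrow> ('e \<Rightarrow> 'e \<Rightarrow> bool)
    \<Rightarrow> 'p set \<Rightarrow> 'p set \<Rightarrow> bool" where
  "minimal_groebner_basis A supp prec G J \<longleftrightarrow>
    groebner_basis A supp prec G J \<and>
    (\<forall>g\<in>G. \<forall>g'\<in>G. g \<noteq> g' \<longrightarrow>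
      max_exp prec (supp g) \<notin> {max_exp prec (supp g') + \<beta> | \<beta>. True})"

definition frac_rel :: "('a, 'b) ring_scheme \<Rightarrow> (('a \<times> 'a) \<times> ('a \<times> 'a)) set" where
  "frac_rel D = {((a, b), (c, d)).
    a \<in> carrier D \<and> b \<in> carrier D - {\<zero>\<^bsub>D\<^esub>} \<and> c \<in> carrier D \<and> d \<in> carrier D - {\<zero>\<^bsub>D\<^esub>} \<and>
    a \<otimes>\<^bsub>D\<^esub> d = c \<otimes>\<^bsub>D\<^esub> b}"

definition fraction :: "('a, 'b) ring_scheme \<Rightarrow> 'a \<Rightarrow> 'a \<Rightarrow> ('a \<times> 'a) set" where
  "fraction D a b = frac_rel D `` {(a, b)}"

definition frac_field :: "('a, 'b) ring_scheme \<Rightarrow> ('a \<times> 'a) set ring" where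
  "frac_field D =
    \<lparr> carrier = (carrier D \<times> (carrier D - {\<zero>\<^bsub>D\<^esub>})) // frac_rel D,
      mult = (\<lambda>X Y. \<Union>(a, b)\<in>X. \<Union>(c, d)\<in>Y. fraction D (a \<otimes>\<^bsub>D\<^esub> c) (b \<otimes>\<^bsub>D\<^esub> d)),
      one = fraction D \<one>\<^bsub>D\<^esub> \<one>\<^bsub>D\<^esub>,
      zero = fraction D \<zero>\<^bsub>D\<^esub> \<one>\<^bsub>D\<^esub>,
      add = (\<lambda>X Y. \<Union>(a, b)\<in>X. \<Union>(c, d)\<in>Y.
        fraction D (a \<otimes>\<^bsub>D\<^esub> d \<oplus>\<^bsub>D\<^esub> c \<otimes>\<^bsub>D\<^esub> b) (b \<otimes>\<^bsub>D\<^esub> d)) \<rparr>"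

definition residue_field :: "('a, 'b) ring_scheme \<Rightarrow> 'a set \<Rightarrow> ('a set \<times> 'a set) set ring" where
  "residue_field R P = frac_field (R Quot P)"

definition residue_map :: "('a, 'b) ring_scheme \<Rightarrow> 'a set \<Rightarrow> 'a \<Rightarrow> ('a set \<times> 'a set) set" where
  "residue_map R P r = fraction (R Quot P) (P +>\<^bsub>R\<^esub> r) \<one>\<^bsub>R Quot P\<^esub>"

definition specialize ::
  "('a, 'b) ring_scheme \<Rightarrow> 'a set \<Rightarrow> (('n::finite \<Rightarrow>\<^sub>0 nat) \<Rightarrow> 'a)
    \<Rightarrow> ('n \<Rightarrow>\<^sub>0 nat) \<Rightarrow> ('a set \<times> 'a set) set" where
  "specialize R P f = (\<lambda>\<alpha>. residue_map R P (f \<alpha>))"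

definition specialize_ideal ::
  "('a, 'b) ring_scheme \<Rightarrow> 'a set \<Rightarrow> (('n::finite \<Rightarrow>\<^sub>0 nat) \<Rightarrow> 'a) set
    \<Rightarrow> (('n \<Rightarrow>\<^sub>0 nat) \<Rightarrow> ('a set \<times> 'a set) set) set" where
  "specialize_ideal R P J = Idl\<^bsub>mpoly_ring (residue_field R P)\<^esub> (specialize R P ` J)"

definition zero_locus :: "('a, 'b) ring_scheme \<Rightarrow> 'a set \<Rightarrow> 'a set set" where
  "zero_locus R I = {P. primeideal P R \<and> I \<subseteq> P}"

end

theory Submission
  imports Defs
begin

text \<open>
  Up to a nonzero scalar, every element of \<open>(J)\<^sub>P\<close> is \<open>(f)\<^sub>P\<close> for some \<open>f \<in> J\<close>, so it suffices to find
  the leading exponent of \<open>(f)\<^sub>P \<noteq> 0\<close> for \<open>f\<close> in \<open>J + k[a,x] Q\<close>. If \<open>lc(f) \<notin> P\<close> and the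
  leading term of \<open>f\<close> is divisible by that of some \<open>g \<in> G - Q\<close>, then \<open>(f)\<^sub>P\<close> and \<open>f\<close>, and \<open>(g)\<^sub>P\<close>
  and \<open>g\<close>, have the same leading exponents in \<open>x\<close>. Otherwise \<open>f\<close> can be reduced without changing the support
  of \<open>(f)\<^sub>P\<close>: by a multiple of some \<open>q \<in> G \<inter> Q\<close>, which vanishes modulo \<open>P\<close>, or, when
  \<open>lc(f) \<in> P\<close>, by the pseudo-reduction \<open>lc(g) f - lc(f) x\<^sup>\<beta> g\<close>, which is \<open>lc(g) f\<close> modulo \<open>P\<close>.
  As \<open><\<close> is a well order, this stops.
\<close>

section \<open>Polynomial rings\<close>

text \<open>The two reductions lower different halves of the leading exponent. The pseudo-reduction
  cancels the whole coefficient at the leading x-exponent of f, so the x-part drops while parameter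
  exponents may grow. Subtracting a multiple of q cancels a single parameter term of lc(f) and in
  general leaves the x-part where it is. Only the order that compares x first and parameters second
  sees both as a descent. No other kind of g occurs: h lies outside P, hence so does every factor
  lc(g) with g in \<open>Gc\<close>, and the remaining elements of G are constants from Q, which
  lies in P. The elements of G belong to \<open>Jt\<close> and not necessarily to J. Nothing is lost
  by this, because the added generators specialize to zero, so every element of \<open>Jt\<close>
  specializes into the ideal generated by the image of J. Division is available in K but not in
  \<open>R\<close>. Parameter terms are therefore cancelled with a quotient of coefficients, whereas
  x-terms are cancelled only after scaling f; the scaling is harmless because the residue field is a
  domain.\<close>

text \<open>Both summands are bounded by \<gamma> in each of finitely many variables. Without this
  finiteness, the coefficients of a product would be the default value of \<open>finsum\<close> on
  infinite sets.\<close>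

lemma finite_add_eq: "finite {p :: ('n::finite \<Rightarrow>\<^sub>0 nat) \<times> ('n \<Rightarrow>\<^sub>0 nat). fst p + snd p = \<gamma>}"
proof -
  let ?L = "{\<alpha> :: 'n \<Rightarrow>\<^sub>0 nat. \<forall>i. Poly_Mapping.lookup \<alpha> i \<le> Poly_Mapping.lookup \<gamma> i}"
  have "finite (PiE UNIV (\<lambda>i. {..Poly_Mapping.lookup \<gamma> i}))"
    by (intro finite_PiE) auto
  then have "finite (Poly_Mapping.lookup ` ?L)"
    by (rule rev_finite_subset) (auto simp: PiE_def)
  then have "finite ?L"
    by (rule finite_imageD) (simp add: inj_on_def)
  then have "finite (?L \<times> ?L)" by simp
  then show ?thesis
    by (rule rev_finite_subset) (auto simp: lookup_add)
qed

text \<open>Turns a nested sum into one sum that can be reindexed, as associativity of the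
  convolution product requires. The induction splits off the fibre over the new point, a copy of
  \<open>B x\<close> under \<open>Pair x\<close>.\<close>

lemma (in abelian_monoid) finsum_Sigma:
  assumes "finite A" and "\<And>x. x \<in> A \<Longrightarrow> finite (B x)"
    and "\<And>x y. x \<in> A \<Longrightarrow> y \<in> B x \<Longrightarrow> f x y \<in> carrier G"
  shows "(\<Oplus>x\<in>A. \<Oplus>y\<in>B x. f x y) = (\<Oplus>p\<in>Sigma A B. f (fst p) (snd p))"
  using assms
proof (induction A)
  case (insert x F)
  have eq: "Sigma (insert x F) B = Pair x ` B x \<union> Sigma F B" by auto
  have "(\<Oplus>p\<in>Pair x ` B x. f (fst p) (snd p)) = (\<Oplus>y\<in>B x. f x y)"
    by (subst finsum_reindex) (auto simp: inj_on_def insert.prems intro!: finsum_cong')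
  moreover have "(\<Oplus>p\<in>Sigma (insert x F) B. f (fst p) (snd p)) =
      (\<Oplus>p\<in>Pair x ` B x. f (fst p) (snd p)) \<oplus> (\<Oplus>p\<in>Sigma F B. f (fst p) (snd p))"
    unfolding eq using insert by (intro finsum_Un_disjoint finite_SigmaI) auto
  moreover have "(\<Oplus>x\<in>insert x F. \<Oplus>y\<in>B x. f x y) = (\<Oplus>y\<in>B x. f x y) \<oplus> (\<Oplus>x\<in>F. \<Oplus>y\<in>B x. f x y)"
    using insert by (intro finsum_insert) (auto intro!: finsum_closed)
  ultimately show ?case using insert by simp
qed simp

lemma mpoly_carrier:
  "f \<in> carrier (mpoly_ring R) \<longleftrightarrow> (\<forall>\<alpha>. f \<alpha> \<in> carrier R) \<and> finite {\<alpha>. f \<alpha> \<noteq> \<zero>\<^bsub>R\<^esub>}"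
  by (simp add: mpoly_ring_def)

lemma mpoly_coeff_closed: "f \<in> carrier (mpoly_ring R) \<Longrightarrow> f \<alpha> \<in> carrier R"
  by (simp add: mpoly_carrier)

lemma mpoly_add [simp]: "(f \<oplus>\<^bsub>mpoly_ring R\<^esub> g) \<alpha> = f \<alpha> \<oplus>\<^bsub>R\<^esub> g \<alpha>"
  by (simp add: mpoly_ring_def)

lemma mpoly_mult:
  "(f \<otimes>\<^bsub>mpoly_ring R\<^esub> g) \<gamma> = (\<Oplus>\<^bsub>R\<^esub>p \<in> {p. fst p + snd p = \<gamma>}. f (fst p) \<otimes>\<^bsub>R\<^esub> g (snd p))"
  by (simp add: mpoly_ring_def)

lemma mpoly_one: "\<one>\<^bsub>mpoly_ring R\<^esub> = (\<lambda>\<alpha>. if \<alpha> = 0 then \<one>\<^bsub>R\<^esub> else \<zero>\<^bsub>R\<^esub>)"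
  by (simp add: mpoly_ring_def)

lemma mpoly_zero: "\<zero>\<^bsub>mpoly_ring R\<^esub> = (\<lambda>\<alpha>. \<zero>\<^bsub>R\<^esub>)"
  by (simp add: mpoly_ring_def)

section \<open>Monomials and the ring axioms of the convolution product\<close>

definition mpoly_monom ::
  "('a, 'b) ring_scheme \<Rightarrow> ('n::finite \<Rightarrow>\<^sub>0 nat) \<Rightarrow> 'a \<Rightarrow> ('n \<Rightarrow>\<^sub>0 nat) \<Rightarrow> 'a" where
  "mpoly_monom R \<beta> c = (\<lambda>\<alpha>. if \<alpha> = \<beta> then c else \<zero>\<^bsub>R\<^esub>)"

context cring
begin

lemma mpoly_monom_closed: "c \<in> carrier R \<Longrightarrow> mpoly_monom R \<beta> c \<in> carrier (mpoly_ring R)"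
  by (auto simp: mpoly_carrier mpoly_monom_def intro!: finite_subset[of _ "{\<beta>}"])

text \<open>Exponents cancel, so (\<beta>, \<alpha>) is the only decomposition of \<beta> + \<alpha>
  with first component \<beta>, and the convolution collapses to one summand.\<close>

lemma mpoly_monom_mult:
  assumes g: "g \<in> carrier (mpoly_ring R)" and c: "c \<in> carrier R"
  shows "(mpoly_monom R \<beta> c \<otimes>\<^bsub>mpoly_ring R\<^esub> g) (\<beta> + \<alpha>) = c \<otimes> g \<alpha>"
proof -
  have "(mpoly_monom R \<beta> c \<otimes>\<^bsub>mpoly_ring R\<^esub> g) (\<beta> + \<alpha>) =
      (\<Oplus>p\<in>{p. fst p + snd p = \<beta> + \<alpha>}. if (\<beta>, \<alpha>) = p then c \<otimes> g (snd p) else \<zero>)"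
    unfolding mpoly_mult
    using g c by (intro finsum_cong') (auto simp: mpoly_monom_def mpoly_carrier)
  also have "\<dots> = c \<otimes> g \<alpha>"
    using g c finite_add_eq by (subst finsum_singleton) (auto simp: mpoly_carrier)
  finally show ?thesis .
qed

text \<open>Covers the exponents not divisible by \<beta>; with the previous lemma, every
  coefficient of a product by a term is known.\<close>

lemma mpoly_monom_mult_0:
  assumes g: "g \<in> carrier (mpoly_ring R)" and "\<And>\<alpha>. \<gamma> \<noteq> \<beta> + \<alpha>"
  shows "(mpoly_monom R \<beta> c \<otimes>\<^bsub>mpoly_ring R\<^esub> g) \<gamma> = \<zero>"
  unfolding mpoly_mult
proof (rule add.finprod_one_eqI)
  fix p assume "p \<in> {p. fst p + snd p = \<gamma>}"
  then have "fst p \<noteq> \<beta>" using assms(2) by auto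
  then show "mpoly_monom R \<beta> c (fst p) \<otimes> g (snd p) = \<zero>"
    using g by (simp add: mpoly_monom_def mpoly_carrier)
qed

lemma mpoly_const_eq_monom: "mpoly_const R = mpoly_monom R 0"
  by (simp add: fun_eq_iff mpoly_const_def mpoly_monom_def)

lemma mpoly_const_mult:
  assumes "g \<in> carrier (mpoly_ring R)" "c \<in> carrier R"
  shows "(mpoly_const R c \<otimes>\<^bsub>mpoly_ring R\<^esub> g) \<alpha> = c \<otimes> g \<alpha>"
  using mpoly_monom_mult[OF assms, of 0 \<alpha>] by (simp add: mpoly_const_eq_monom)

lemma mpoly_mult_closed:
  fixes f g :: "('n::finite \<Rightarrow>\<^sub>0 nat) \<Rightarrow> 'a"
  assumes f: "f \<in> carrier (mpoly_ring R)" and g: "g \<in> carrier (mpoly_ring R)"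
  shows "f \<otimes>\<^bsub>mpoly_ring R\<^esub> g \<in> carrier (mpoly_ring R)"
proof -
  \<comment> \<open>The sumset of the two supports contains the support of the product.\<close>
  let ?S = "(\<lambda>p. fst p + snd p) ` ({\<alpha>. f \<alpha> \<noteq> \<zero>} \<times> {\<alpha>. g \<alpha> \<noteq> \<zero>})"
  have "finite ?S" using f g by (auto simp: mpoly_carrier)
  moreover have "(f \<otimes>\<^bsub>mpoly_ring R\<^esub> g) \<gamma> = \<zero>" if "\<gamma> \<notin> ?S" for \<gamma>
    unfolding mpoly_mult
  proof (rule add.finprod_one_eqI)
    fix p assume "p \<in> {p. fst p + snd p = \<gamma>}"
    with that have "p \<notin> {\<alpha>. f \<alpha> \<noteq> \<zero>} \<times> {\<alpha>. g \<alpha> \<noteq> \<zero>}" by blast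
    then have "f (fst p) = \<zero> \<or> g (snd p) = \<zero>" by (simp add: mem_Times_iff)
    then show "f (fst p) \<otimes> g (snd p) = \<zero>"
      using f g by (auto simp: mpoly_carrier)
  qed
  ultimately have "finite {\<gamma>. (f \<otimes>\<^bsub>mpoly_ring R\<^esub> g) \<gamma> \<noteq> \<zero>}"
    by (auto elim!: rev_finite_subset)
  then show ?thesis
    using f g by (auto simp: mpoly_carrier mpoly_mult intro!: finsum_closed)
qed

lemma mpoly_mult_comm:
  fixes f g :: "('n::finite \<Rightarrow>\<^sub>0 nat) \<Rightarrow> 'a"
  assumes f: "f \<in> carrier (mpoly_ring R)" and g: "g \<in> carrier (mpoly_ring R)"
  shows "f \<otimes>\<^bsub>mpoly_ring R\<^esub> g = g \<otimes>\<^bsub>mpoly_ring R\<^esub> f"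
proof
  fix \<gamma> :: "'n \<Rightarrow>\<^sub>0 nat"
  have eq: "prod.swap ` {p. fst p + snd p = \<gamma>} = {p. fst p + snd p = \<gamma>}"
    by (auto simp: image_iff intro: add.commute)
  have "(\<Oplus>p\<in>prod.swap ` {p. fst p + snd p = \<gamma>}. f (fst p) \<otimes> g (snd p))
      = (\<Oplus>p\<in>{p. fst p + snd p = \<gamma>}. f (fst (prod.swap p)) \<otimes> g (snd (prod.swap p)))"
    using f g by (intro finsum_reindex) (auto simp: mpoly_carrier)
  also have "\<dots> = (\<Oplus>p\<in>{p. fst p + snd p = \<gamma>}. g (fst p) \<otimes> f (snd p))"
    using f g by (intro finsum_cong') (auto simp: mpoly_carrier m_comm)
  finally show "(f \<otimes>\<^bsub>mpoly_ring R\<^esub> g) \<gamma> = (g \<otimes>\<^bsub>mpoly_ring R\<^esub> f) \<gamma>"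
    unfolding eq mpoly_mult .
qed

lemma mpoly_mult_assoc:
  fixes f g h :: "('n::finite \<Rightarrow>\<^sub>0 nat) \<Rightarrow> 'a"
  assumes f: "f \<in> carrier (mpoly_ring R)" and g: "g \<in> carrier (mpoly_ring R)"
    and h: "h \<in> carrier (mpoly_ring R)"
  shows "f \<otimes>\<^bsub>mpoly_ring R\<^esub> g \<otimes>\<^bsub>mpoly_ring R\<^esub> h = f \<otimes>\<^bsub>mpoly_ring R\<^esub> (g \<otimes>\<^bsub>mpoly_ring R\<^esub> h)"
proof
  fix \<gamma>
  define D where "D \<delta> = {p :: ('n \<Rightarrow>\<^sub>0 nat) \<times> ('n \<Rightarrow>\<^sub>0 nat). fst p + snd p = \<delta>}" for \<delta>
  \<comment> \<open>Both bracketings sum over triples (s, t, r) with s + t + r = \<gamma>.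
    \<open>S1\<close> stores a triple as ((s + t, r), (s, t)) and \<open>S2\<close> as ((s, t + r),
    (t, r)); the map \<open>s\<close> translates the first encoding into the second.\<close>
  define s :: "(('n \<Rightarrow>\<^sub>0 nat) \<times> ('n \<Rightarrow>\<^sub>0 nat)) \<times> (('n \<Rightarrow>\<^sub>0 nat) \<times> ('n \<Rightarrow>\<^sub>0 nat)) \<Rightarrow> _"
    where "s = (\<lambda>((p, r), (s, t)). ((s, t + r), (t, r)))"
  define S1 where "S1 = Sigma (D \<gamma>) (\<lambda>u. D (fst u))"
  define S2 where "S2 = Sigma (D \<gamma>) (\<lambda>u. D (snd u))"
  have fin: "finite (D \<delta>)" for \<delta> by (simp add: D_def finite_add_eq)
  have s: "s ` S1 = S2"
  proof
    show "s ` S1 \<subseteq> S2" by (auto simp: S1_def S2_def s_def D_def add.assoc)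
    show "S2 \<subseteq> s ` S1"
    proof
      fix x assume "x \<in> S2"
      then obtain p q t r where "x = ((p, q), (t, r))" "p + q = \<gamma>" "t + r = q"
        by (auto simp: S2_def D_def)
      then have "x = s ((p + t, r), (p, t))" "((p + t, r), (p, t)) \<in> S1"
        by (auto simp: s_def S1_def D_def add.assoc)
      then show "x \<in> s ` S1" by blast
    qed
  qed
  have inj: "inj_on s S1"
    by (auto simp: inj_on_def s_def S1_def D_def)
  note [simp] = mpoly_coeff_closed[OF f] mpoly_coeff_closed[OF g] mpoly_coeff_closed[OF h]
  have "(f \<otimes>\<^bsub>mpoly_ring R\<^esub> g \<otimes>\<^bsub>mpoly_ring R\<^esub> h) \<gamma> =
      (\<Oplus>u\<in>D \<gamma>. (\<Oplus>v\<in>D (fst u). f (fst v) \<otimes> g (snd v)) \<otimes> h (snd u))"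
    by (simp add: mpoly_mult D_def)
  also have "\<dots> = (\<Oplus>u\<in>D \<gamma>. \<Oplus>v\<in>D (fst u). f (fst v) \<otimes> g (snd v) \<otimes> h (snd u))"
    by (intro finsum_cong') (auto simp: finsum_ldistr fin intro!: finsum_closed)
  also have "\<dots> = (\<Oplus>p\<in>S1. f (fst (snd p)) \<otimes> g (snd (snd p)) \<otimes> h (snd (fst p)))"
    unfolding S1_def by (intro finsum_Sigma fin) auto
  also have "\<dots> = (\<Oplus>p\<in>S1. f (fst (fst (s p))) \<otimes> (g (fst (snd (s p))) \<otimes> h (snd (snd (s p)))))"
    by (intro finsum_cong') (auto simp: s_def m_assoc)
  also have "\<dots> = (\<Oplus>p\<in>s ` S1. f (fst (fst p)) \<otimes> (g (fst (snd p)) \<otimes> h (snd (snd p))))"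
    using inj by (intro finsum_reindex[symmetric]) auto
  also have "\<dots> = (\<Oplus>u\<in>D \<gamma>. \<Oplus>v\<in>D (snd u). f (fst u) \<otimes> (g (fst v) \<otimes> h (snd v)))"
    unfolding s S2_def by (intro finsum_Sigma[symmetric] fin) auto
  also have "\<dots> = (\<Oplus>u\<in>D \<gamma>. f (fst u) \<otimes> (\<Oplus>v\<in>D (snd u). g (fst v) \<otimes> h (snd v)))"
    by (intro finsum_cong') (auto simp: finsum_rdistr fin intro!: finsum_closed)
  also have "\<dots> = (f \<otimes>\<^bsub>mpoly_ring R\<^esub> (g \<otimes>\<^bsub>mpoly_ring R\<^esub> h)) \<gamma>"
    by (simp add: mpoly_mult D_def)
  finally show "(f \<otimes>\<^bsub>mpoly_ring R\<^esub> g \<otimes>\<^bsub>mpoly_ring R\<^esub> h) \<gamma> = (f \<otimes>\<^bsub>mpoly_ring R\<^esub> (g \<otimes>\<^bsub>mpoly_ring R\<^esub> h)) \<gamma>" .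
qed

lemma mpoly_ring_cring: "cring (mpoly_ring R :: (('n::finite \<Rightarrow>\<^sub>0 nat) \<Rightarrow> 'a) ring)"
proof (rule cringI)
  let ?A = "mpoly_ring R :: (('n \<Rightarrow>\<^sub>0 nat) \<Rightarrow> 'a) ring"
  show "abelian_group ?A"
  proof (rule abelian_groupI)
    fix f g assume fg: "f \<in> carrier ?A" "g \<in> carrier ?A"
    then have "finite ({\<alpha>. f \<alpha> \<noteq> \<zero>} \<union> {\<alpha>. g \<alpha> \<noteq> \<zero>})" by (simp add: mpoly_carrier)
    then have "finite {\<alpha>. f \<alpha> \<oplus> g \<alpha> \<noteq> \<zero>}" by (rule rev_finite_subset) auto
    then show "f \<oplus>\<^bsub>?A\<^esub> g \<in> carrier ?A" using fg by (simp add: mpoly_carrier)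
  next
    fix f assume f: "f \<in> carrier ?A"
    then have "(\<lambda>\<alpha>. \<ominus> f \<alpha>) \<in> carrier ?A"
      by (auto simp: mpoly_carrier elim!: rev_finite_subset)
    moreover have "(\<lambda>\<alpha>. \<ominus> f \<alpha>) \<oplus>\<^bsub>?A\<^esub> f = \<zero>\<^bsub>?A\<^esub>"
      using f by (auto simp: mpoly_carrier mpoly_zero l_neg)
    ultimately show "\<exists>g\<in>carrier ?A. g \<oplus>\<^bsub>?A\<^esub> f = \<zero>\<^bsub>?A\<^esub>" by blast
  qed (auto simp: mpoly_carrier mpoly_zero fun_eq_iff a_ac)
  have one: "\<one>\<^bsub>?A\<^esub> = mpoly_const R \<one>" by (simp add: mpoly_one mpoly_const_def)
  have one_closed: "\<one>\<^bsub>?A\<^esub> \<in> carrier ?A"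
    by (simp add: one mpoly_const_eq_monom mpoly_monom_closed)
  show "comm_monoid ?A"
  proof (rule comm_monoidI)
    fix f assume "f \<in> carrier ?A"
    then show "\<one>\<^bsub>?A\<^esub> \<otimes>\<^bsub>?A\<^esub> f = f"
      unfolding one by (intro ext) (simp add: mpoly_const_mult mpoly_coeff_closed)
  qed (simp_all add: one_closed mpoly_mult_closed mpoly_mult_assoc, simp add: mpoly_mult_comm)
next
  let ?A = "mpoly_ring R :: (('n \<Rightarrow>\<^sub>0 nat) \<Rightarrow> 'a) ring"
  fix f g h assume fgh: "f \<in> carrier ?A" "g \<in> carrier ?A" "h \<in> carrier ?A"
  note [simp] = fgh[THEN mpoly_coeff_closed]
  show "(f \<oplus>\<^bsub>?A\<^esub> g) \<otimes>\<^bsub>?A\<^esub> h = f \<otimes>\<^bsub>?A\<^esub> h \<oplus>\<^bsub>?A\<^esub> g \<otimes>\<^bsub>?A\<^esub> h"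
  proof
    fix \<gamma>
    have "(\<Oplus>p \<in> {p. fst p + snd p = \<gamma>}. f (fst p) \<otimes> h (snd p) \<oplus> g (fst p) \<otimes> h (snd p))
      = (f \<otimes>\<^bsub>?A\<^esub> h \<oplus>\<^bsub>?A\<^esub> g \<otimes>\<^bsub>?A\<^esub> h) \<gamma>"
      unfolding mpoly_mult mpoly_add by (intro finsum_addf) auto
    then show "((f \<oplus>\<^bsub>?A\<^esub> g) \<otimes>\<^bsub>?A\<^esub> h) \<gamma> = (f \<otimes>\<^bsub>?A\<^esub> h \<oplus>\<^bsub>?A\<^esub> g \<otimes>\<^bsub>?A\<^esub> h) \<gamma>"
      by (simp add: mpoly_mult l_distr)
  qed
qed

text \<open>Negation in a ring is characterized abstractly, not given by a formula, so the
  coefficientwise form comes from uniqueness of additive inverses in R.\<close>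

lemma mpoly_minus:
  assumes f: "f \<in> carrier (mpoly_ring R)" and g: "g \<in> carrier (mpoly_ring R)"
  shows "(f \<ominus>\<^bsub>mpoly_ring R\<^esub> g) \<alpha> = f \<alpha> \<ominus> g \<alpha>"
proof -
  interpret A: cring "mpoly_ring R" by (rule mpoly_ring_cring)
  have "(\<ominus>\<^bsub>mpoly_ring R\<^esub> g) \<alpha> \<oplus> g \<alpha> = (\<ominus>\<^bsub>mpoly_ring R\<^esub> g \<oplus>\<^bsub>mpoly_ring R\<^esub> g) \<alpha>"
    by simp
  also have "\<dots> = \<zero>"
    using g by (simp add: A.l_neg mpoly_zero)
  finally have "\<ominus> g \<alpha> = (\<ominus>\<^bsub>mpoly_ring R\<^esub> g) \<alpha>"
    using g by (intro minus_equality) (auto intro: mpoly_coeff_closed)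
  then show ?thesis
    by (simp add: a_minus_def)
qed

end

section \<open>Fraction fields and residue fields\<close>

text \<open>The operations of \<open>frac_field\<close> take a union over all representatives. Once
  the value does not depend on the representatives, that union is the common value.\<close>

lemma UN_pairs_constant:
  assumes "X \<noteq> {}" "Y \<noteq> {}"
    and eq: "\<And>a b c d. (a, b) \<in> X \<Longrightarrow> (c, d) \<in> Y \<Longrightarrow> F a b c d = C"
  shows "(\<Union>(a, b)\<in>X. \<Union>(c, d)\<in>Y. F a b c d) = C"
proof -
  have "(\<Union>(c, d)\<in>Y. F a b c d) = C" if "(a, b) \<in> X" for a b
  proof -
    have "(\<Union>(c, d)\<in>Y. F a b c d) = (\<Union>q\<in>Y. C)"
      using eq[OF that] by (intro SUP_cong) auto
    then show ?thesis using assms(2) by simp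
  qed
  then have "(\<Union>(a, b)\<in>X. \<Union>(c, d)\<in>Y. F a b c d) = (\<Union>p\<in>X. C)"
    by (intro SUP_cong refl) (simp only: split_paired_all case_prod_conv)
  then show ?thesis using assms(1) by simp
qed

context domain
begin

lemma frac_rel_iff:
  "((a, b), (c, d)) \<in> frac_rel R \<longleftrightarrow>
    a \<in> carrier R \<and> b \<in> carrier R - {\<zero>} \<and> c \<in> carrier R \<and> d \<in> carrier R - {\<zero>} \<and>
    a \<otimes> d = c \<otimes> b"
  by (simp add: frac_rel_def)

lemma equiv_frac_rel: "equiv (carrier R \<times> (carrier R - {\<zero>})) (frac_rel R)"
proof (rule equivI)
  show "frac_rel R \<subseteq> (carrier R \<times> (carrier R - {\<zero>})) \<times> (carrier R \<times> (carrier R - {\<zero>}))"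
    by (auto simp: frac_rel_def)
  show "refl_on (carrier R \<times> (carrier R - {\<zero>})) (frac_rel R)"
    by (auto simp: refl_on_def frac_rel_def)
  show "sym (frac_rel R)"
    by (auto simp: sym_def frac_rel_def)
  show "trans (frac_rel R)"
  proof (rule transI)
    fix x y z assume "(x, y) \<in> frac_rel R" "(y, z) \<in> frac_rel R"
    moreover obtain a b c d e f where xyz: "x = (a, b)" "y = (c, d)" "z = (e, f)"
      by (metis surj_pair)
    ultimately have *: "a \<in> carrier R" "b \<in> carrier R - {\<zero>}" "c \<in> carrier R"
      "d \<in> carrier R - {\<zero>}" "e \<in> carrier R" "f \<in> carrier R - {\<zero>}"
      and eq: "a \<otimes> d = c \<otimes> b" "c \<otimes> f = e \<otimes> d"
      by (auto simp: frac_rel_iff)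
    \<comment> \<open>Transitivity is where integrality enters: both given equations can be used
      only after multiplying by the middle denominator d, which is then cancelled.\<close>
    have "d \<otimes> (a \<otimes> f) = (a \<otimes> d) \<otimes> f" using * by (simp add: m_ac)
    also have "\<dots> = (c \<otimes> f) \<otimes> b" unfolding eq(1) using * by (simp add: m_ac)
    also have "\<dots> = d \<otimes> (e \<otimes> b)" unfolding eq(2) using * by (simp add: m_ac)
    finally have "a \<otimes> f = e \<otimes> b" using * by (simp add: m_lcancel)
    then show "(x, z) \<in> frac_rel R" using * by (simp add: xyz frac_rel_iff)
  qed
qed

lemma fraction_eq_iff:
  assumes "a \<in> carrier R" "b \<in> carrier R" "b \<noteq> \<zero>" "c \<in> carrier R" "d \<in> carrier R" "d \<noteq> \<zero>"
  shows "fraction R a b = fraction R c d \<longleftrightarrow> a \<otimes> d = c \<otimes> b"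
  unfolding fraction_def using assms eq_equiv_class_iff[OF equiv_frac_rel, of "(a, b)" "(c, d)"]
  by (simp add: frac_rel_iff)

lemma fraction_closed:
  assumes "a \<in> carrier R" "b \<in> carrier R" "b \<noteq> \<zero>"
  shows "fraction R a b \<in> carrier (frac_field R)"
  using assms by (auto simp: frac_field_def fraction_def intro!: quotientI)

lemma frac_field_cases:
  assumes "X \<in> carrier (frac_field R)"
  obtains a b where "a \<in> carrier R" "b \<in> carrier R" "b \<noteq> \<zero>" "X = fraction R a b"
  using assms by (auto simp: frac_field_def fraction_def elim!: quotientE)

lemma fraction_self:
  assumes "a \<in> carrier R" "b \<in> carrier R" "b \<noteq> \<zero>"
  shows "(a, b) \<in> fraction R a b"
  using assms by (auto simp: fraction_def frac_rel_iff)

lemma fraction_memD: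
  assumes "(a', b') \<in> fraction R a b"
  shows "a' \<in> carrier R" "b' \<in> carrier R" "b' \<noteq> \<zero>" "a \<otimes> b' = a' \<otimes> b"
  using assms by (auto simp: fraction_def frac_rel_iff)

text \<open>Cross-multiplication shows that all representatives give the same fraction; integrality
  keeps the new denominators nonzero.\<close>

lemma frac_field_mult:
  assumes "a \<in> carrier R" "b \<in> carrier R" "b \<noteq> \<zero>" "c \<in> carrier R" "d \<in> carrier R" "d \<noteq> \<zero>"
  shows "fraction R a b \<otimes>\<^bsub>frac_field R\<^esub> fraction R c d = fraction R (a \<otimes> c) (b \<otimes> d)"
proof -
  have "fraction R (a' \<otimes> c') (b' \<otimes> d') = fraction R (a \<otimes> c) (b \<otimes> d)"
    if "(a', b') \<in> fraction R a b" "(c', d') \<in> fraction R c d" for a' b' c' d'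
  proof (subst fraction_eq_iff)
    note * = assms fraction_memD(1-3)[OF that(1)] fraction_memD(1-3)[OF that(2)]
    note eq = fraction_memD(4)[OF that(1)] fraction_memD(4)[OF that(2)]
    have "(a' \<otimes> c') \<otimes> (b \<otimes> d) = (a' \<otimes> b) \<otimes> (c' \<otimes> d)" using * by (simp add: m_ac)
    also have "\<dots> = (a \<otimes> b') \<otimes> (c \<otimes> d')" unfolding eq ..
    also have "\<dots> = (a \<otimes> c) \<otimes> (b' \<otimes> d')" using * by (simp add: m_ac)
    finally show "(a' \<otimes> c') \<otimes> (b \<otimes> d) = (a \<otimes> c) \<otimes> (b' \<otimes> d')" .
  qed (use assms fraction_memD(1-3)[OF that(1)] fraction_memD(1-3)[OF that(2)]
      in \<open>simp_all add: integral_iff\<close>)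
  moreover have "fraction R a b \<noteq> {}" "fraction R c d \<noteq> {}"
    using fraction_self[OF assms(1-3)] fraction_self[OF assms(4-6)] by blast+
  ultimately show ?thesis
    unfolding frac_field_def by (simp del: UN_simps, intro UN_pairs_constant)
qed

lemma frac_field_add:
  assumes "a \<in> carrier R" "b \<in> carrier R" "b \<noteq> \<zero>" "c \<in> carrier R" "d \<in> carrier R" "d \<noteq> \<zero>"
  shows "fraction R a b \<oplus>\<^bsub>frac_field R\<^esub> fraction R c d =
    fraction R (a \<otimes> d \<oplus> c \<otimes> b) (b \<otimes> d)"
proof -
  have "fraction R (a' \<otimes> d' \<oplus> c' \<otimes> b') (b' \<otimes> d') = fraction R (a \<otimes> d \<oplus> c \<otimes> b) (b \<otimes> d)"
    if "(a', b') \<in> fraction R a b" "(c', d') \<in> fraction R c d" for a' b' c' d'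
  proof (subst fraction_eq_iff)
    note * = assms fraction_memD(1-3)[OF that(1)] fraction_memD(1-3)[OF that(2)]
    note eq = fraction_memD(4)[OF that(1)] fraction_memD(4)[OF that(2)]
    have "(a' \<otimes> d' \<oplus> c' \<otimes> b') \<otimes> (b \<otimes> d) =
        (a' \<otimes> b) \<otimes> (d' \<otimes> d) \<oplus> (c' \<otimes> d) \<otimes> (b' \<otimes> b)"
      using * by (simp add: m_ac l_distr r_distr)
    also have "\<dots> = (a \<otimes> b') \<otimes> (d' \<otimes> d) \<oplus> (c \<otimes> d') \<otimes> (b' \<otimes> b)" unfolding eq ..
    also have "\<dots> = (a \<otimes> d \<oplus> c \<otimes> b) \<otimes> (b' \<otimes> d')" using * by (simp add: m_ac l_distr r_distr)
    finally show "(a' \<otimes> d' \<oplus> c' \<otimes> b') \<otimes> (b \<otimes> d) = (a \<otimes> d \<oplus> c \<otimes> b) \<otimes> (b' \<otimes> d')" .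
  qed (use assms fraction_memD(1-3)[OF that(1)] fraction_memD(1-3)[OF that(2)]
      in \<open>simp_all add: integral_iff\<close>)
  moreover have "fraction R a b \<noteq> {}" "fraction R c d \<noteq> {}"
    using fraction_self[OF assms(1-3)] fraction_self[OF assms(4-6)] by blast+
  ultimately show ?thesis
    unfolding frac_field_def by (simp del: UN_simps, intro UN_pairs_constant)
qed

lemma frac_field_zero: "\<zero>\<^bsub>frac_field R\<^esub> = fraction R \<zero> \<one>"
  by (simp add: frac_field_def)

lemma frac_field_one: "\<one>\<^bsub>frac_field R\<^esub> = fraction R \<one> \<one>"
  by (simp add: frac_field_def)

lemma fraction_eq_zero_iff:
  assumes "a \<in> carrier R" "b \<in> carrier R" "b \<noteq> \<zero>"
  shows "fraction R a b = \<zero>\<^bsub>frac_field R\<^esub> \<longleftrightarrow> a = \<zero>"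
  using assms by (simp add: frac_field_zero fraction_eq_iff)

text \<open>Integrality of the fraction field is what later keeps the support of a polynomial
  unchanged when it is multiplied by a nonzero scalar.\<close>

lemma frac_field_domain: "domain (frac_field R)"
proof -
  note [simp] = frac_field_mult frac_field_add frac_field_zero frac_field_one fraction_closed
    integral_iff fraction_eq_iff
  note arith = l_distr r_distr m_ac a_ac
  let ?F = "frac_field R"
  have "cring ?F"
  proof (rule cringI)
    show "abelian_group ?F"
    proof (rule abelian_groupI)
      show "\<zero>\<^bsub>?F\<^esub> \<in> carrier ?F" by simp
      fix X assume "X \<in> carrier ?F"
      then obtain a b where X: "a \<in> carrier R" "b \<in> carrier R" "b \<noteq> \<zero>" "X = fraction R a b"
        by (rule frac_field_cases)
      then show "\<zero>\<^bsub>?F\<^esub> \<oplus>\<^bsub>?F\<^esub> X = X" by simp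
      have "fraction R (\<ominus> a) b \<oplus>\<^bsub>?F\<^esub> X = \<zero>\<^bsub>?F\<^esub>"
        using X by (simp add: l_minus l_neg)
      then show "\<exists>Y\<in>carrier ?F. Y \<oplus>\<^bsub>?F\<^esub> X = \<zero>\<^bsub>?F\<^esub>"
        using X by (metis a_inv_closed fraction_closed)
      fix Y assume "Y \<in> carrier ?F"
      then obtain c d where Y: "c \<in> carrier R" "d \<in> carrier R" "d \<noteq> \<zero>" "Y = fraction R c d"
        by (rule frac_field_cases)
      show "X \<oplus>\<^bsub>?F\<^esub> Y \<in> carrier ?F" using X Y by simp
      show "X \<oplus>\<^bsub>?F\<^esub> Y = Y \<oplus>\<^bsub>?F\<^esub> X" using X Y by (simp add: arith)
      fix Z assume "Z \<in> carrier ?F"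
      then obtain e f where "e \<in> carrier R" "f \<in> carrier R" "f \<noteq> \<zero>" "Z = fraction R e f"
        by (rule frac_field_cases)
      then show "X \<oplus>\<^bsub>?F\<^esub> Y \<oplus>\<^bsub>?F\<^esub> Z = X \<oplus>\<^bsub>?F\<^esub> (Y \<oplus>\<^bsub>?F\<^esub> Z)"
        using X Y by (simp add: arith)
    qed
    show "comm_monoid ?F"
    proof (rule comm_monoidI)
      show "\<one>\<^bsub>?F\<^esub> \<in> carrier ?F" by simp
      fix X assume "X \<in> carrier ?F"
      then obtain a b where X: "a \<in> carrier R" "b \<in> carrier R" "b \<noteq> \<zero>" "X = fraction R a b"
        by (rule frac_field_cases)
      then show "\<one>\<^bsub>?F\<^esub> \<otimes>\<^bsub>?F\<^esub> X = X" by simp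
      fix Y assume "Y \<in> carrier ?F"
      then obtain c d where Y: "c \<in> carrier R" "d \<in> carrier R" "d \<noteq> \<zero>" "Y = fraction R c d"
        by (rule frac_field_cases)
      show "X \<otimes>\<^bsub>?F\<^esub> Y \<in> carrier ?F" using X Y by simp
      show "X \<otimes>\<^bsub>?F\<^esub> Y = Y \<otimes>\<^bsub>?F\<^esub> X" using X Y by (simp add: m_comm)
      fix Z assume "Z \<in> carrier ?F"
      then obtain e f where "e \<in> carrier R" "f \<in> carrier R" "f \<noteq> \<zero>" "Z = fraction R e f"
        by (rule frac_field_cases)
      then show "X \<otimes>\<^bsub>?F\<^esub> Y \<otimes>\<^bsub>?F\<^esub> Z = X \<otimes>\<^bsub>?F\<^esub> (Y \<otimes>\<^bsub>?F\<^esub> Z)"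
        using X Y by (simp add: m_assoc)
    qed
    fix X Y Z assume "X \<in> carrier ?F" "Y \<in> carrier ?F" "Z \<in> carrier ?F"
    moreover obtain a b where "X \<in> carrier ?F \<Longrightarrow> a \<in> carrier R \<and> b \<in> carrier R \<and> b \<noteq> \<zero> \<and> X = fraction R a b"
      by (metis frac_field_cases)
    moreover obtain c d where "Y \<in> carrier ?F \<Longrightarrow> c \<in> carrier R \<and> d \<in> carrier R \<and> d \<noteq> \<zero> \<and> Y = fraction R c d"
      by (metis frac_field_cases)
    moreover obtain e f where "Z \<in> carrier ?F \<Longrightarrow> e \<in> carrier R \<and> f \<in> carrier R \<and> f \<noteq> \<zero> \<and> Z = fraction R e f"
      by (metis frac_field_cases)
    ultimately show "(X \<oplus>\<^bsub>?F\<^esub> Y) \<otimes>\<^bsub>?F\<^esub> Z = X \<otimes>\<^bsub>?F\<^esub> Z \<oplus>\<^bsub>?F\<^esub> Y \<otimes>\<^bsub>?F\<^esub> Z"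
      by (simp add: arith)
  qed
  moreover have "domain_axioms ?F"
  proof (rule domain_axioms.intro)
    show "\<one>\<^bsub>?F\<^esub> \<noteq> \<zero>\<^bsub>?F\<^esub>" by simp
    fix X Y assume XY: "X \<otimes>\<^bsub>?F\<^esub> Y = \<zero>\<^bsub>?F\<^esub>" and "X \<in> carrier ?F" "Y \<in> carrier ?F"
    then obtain a b c d where
      *: "a \<in> carrier R" "b \<in> carrier R" "b \<noteq> \<zero>" "X = fraction R a b"
        "c \<in> carrier R" "d \<in> carrier R" "d \<noteq> \<zero>" "Y = fraction R c d"
      by (metis frac_field_cases)
    then have "a \<otimes> c = \<zero>" using XY by simp
    then have "a = \<zero> \<or> c = \<zero>" using * by simp
    then show "X = \<zero>\<^bsub>?F\<^esub> \<or> Y = \<zero>\<^bsub>?F\<^esub>" using * by auto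
  qed
  ultimately show ?thesis by (simp add: domain_def)
qed

end

section \<open>The residue field of a prime ideal\<close>

context primeideal
begin

lemma residue_field_domain: "domain (residue_field R I)"
  unfolding residue_field_def by (rule domain.frac_field_domain[OF quotient_is_domain])

lemma residue_map_hom: "residue_map R I \<in> ring_hom R (residue_field R I)"
proof -
  interpret D: domain "R Quot I" by (rule quotient_is_domain)
  note h = ring_hom_memE[OF rcos_ring_hom]
  show ?thesis
    unfolding residue_field_def residue_map_def
    by (rule ring_hom_memI)
      (simp_all add: h D.fraction_closed D.frac_field_mult D.frac_field_add D.frac_field_one)
qed

text \<open>The dictionary between membership in the prime ideal and vanishing after specialization.
  A fraction vanishes iff its numerator does, and the zero of the quotient ring is the coset
  \<open>I\<close> itself.\<close>

lemma residue_map_eq_zero_iff: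
  assumes "r \<in> carrier R"
  shows "residue_map R I r = \<zero>\<^bsub>residue_field R I\<^esub> \<longleftrightarrow> r \<in> I"
proof -
  interpret D: domain "R Quot I" by (rule quotient_is_domain)
  have "I +> r \<in> carrier (R Quot I)" using ring_hom_memE(1)[OF rcos_ring_hom assms] .
  moreover have "I +> r = I \<longleftrightarrow> r \<in> I"
    using assms rcos_const_imp_mem a_rcos_zero[OF ideal_axioms] by blast
  ultimately show ?thesis
    by (simp add: residue_map_def residue_field_def D.fraction_eq_zero_iff) (simp add: FactRing_def)
qed

text \<open>Numerator and denominator are lifted to R; a nonzero denominator lifts to an element
  outside I. Multiplying out keeps both sides of the equation free of inverses.\<close>

lemma residue_field_denominator:
  assumes "X \<in> carrier (residue_field R I)"
  obtains r s where "r \<in> carrier R" "s \<in> carrier R - I"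
    "residue_map R I s \<otimes>\<^bsub>residue_field R I\<^esub> X = residue_map R I r"
proof -
  interpret D: domain "R Quot I" by (rule quotient_is_domain)
  obtain a b where *: "a \<in> carrier (R Quot I)" "b \<in> carrier (R Quot I)" "b \<noteq> \<zero>\<^bsub>R Quot I\<^esub>"
    "X = fraction (R Quot I) a b"
    using assms unfolding residue_field_def by (rule D.frac_field_cases)
  from *(1,2) obtain r s where rs: "r \<in> carrier R" "s \<in> carrier R" "a = I +> r" "b = I +> s"
    by (auto simp: FactRing_def A_RCOSETS_def')
  have "s \<notin> I"
  proof
    assume "s \<in> I"
    then have "b = \<zero>\<^bsub>R Quot I\<^esub>"
      using a_rcos_zero[OF ideal_axioms] rs by (simp add: FactRing_def)
    with * show False by simp
  qed
  moreover have "residue_map R I s \<otimes>\<^bsub>residue_field R I\<^esub> X = residue_map R I r"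
    using * rs unfolding residue_map_def residue_field_def
    by (simp add: D.frac_field_mult D.fraction_eq_iff D.m_ac)
  ultimately show thesis using rs that by blast
qed

end

section \<open>Leading exponents\<close>

text \<open>\<open>max_exp\<close> is a definite description, so a candidate must also be unique:
  two maxima would lie strictly below each other.\<close>

lemma max_exp_eqI:
  assumes "monomial_order prec" "\<alpha> \<in> S" "\<And>\<beta>. \<beta> \<in> S \<Longrightarrow> \<beta> \<noteq> \<alpha> \<Longrightarrow> prec \<beta> \<alpha>"
  shows "max_exp prec S = \<alpha>"
  unfolding max_exp_def
proof (rule the_equality)
  fix \<alpha>' assume *: "\<alpha>' \<in> S \<and> (\<forall>\<beta>\<in>S. \<beta> \<noteq> \<alpha>' \<longrightarrow> prec \<beta> \<alpha>')"
  show "\<alpha>' = \<alpha>"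
  proof (rule ccontr)
    assume "\<alpha>' \<noteq> \<alpha>"
    then have "prec \<alpha> \<alpha>'" "prec \<alpha>' \<alpha>" using * assms(2,3) by auto
    then show False using assms(1) unfolding monomial_order_def by (meson irreflpD transpD)
  qed
qed (use assms in auto)

lemma max_exp_exists:
  assumes "monomial_order prec" "finite S" "S \<noteq> {}"
  shows "\<exists>\<alpha>\<in>S. \<forall>\<beta>\<in>S. \<beta> \<noteq> \<alpha> \<longrightarrow> prec \<beta> \<alpha>"
  using assms(2,3)
proof (induction S rule: finite_ne_induct)
  case (insert x F)
  then obtain \<alpha> where \<alpha>: "\<alpha> \<in> F" "\<And>\<beta>. \<beta> \<in> F \<Longrightarrow> \<beta> \<noteq> \<alpha> \<Longrightarrow> prec \<beta> \<alpha>" by blast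
  then have "x \<noteq> \<alpha>" using insert by blast
  then consider "prec x \<alpha>" | "prec \<alpha> x"
    using assms(1) unfolding monomial_order_def by (metis totalpD)
  then show ?case
  proof cases
    case 1
    then show ?thesis using \<alpha> by (intro bexI[of _ \<alpha>]) auto
  next
    case 2
    then have "prec \<beta> x" if "\<beta> \<in> F" for \<beta>
      using that \<alpha> assms(1) unfolding monomial_order_def by (metis transpD)
    then show ?thesis by (intro bexI[of _ x]) auto
  qed
qed simp

lemma
  assumes "monomial_order prec" "finite S" "S \<noteq> {}"
  shows max_exp_in: "max_exp prec S \<in> S"
    and max_exp_max: "\<beta> \<in> S \<Longrightarrow> \<beta> \<noteq> max_exp prec S \<Longrightarrow> prec \<beta> (max_exp prec S)"
proof -
  obtain \<alpha> where \<alpha>: "\<alpha> \<in> S" "\<And>\<beta>. \<beta> \<in> S \<Longrightarrow> \<beta> \<noteq> \<alpha> \<Longrightarrow> prec \<beta> \<alpha>"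
    using max_exp_exists[OF assms] by blast
  have "max_exp prec S = \<alpha>" using \<alpha> by (rule max_exp_eqI[OF assms(1)])
  then show "max_exp prec S \<in> S"
    and "\<beta> \<in> S \<Longrightarrow> \<beta> \<noteq> max_exp prec S \<Longrightarrow> prec \<beta> (max_exp prec S)"
    using \<alpha> by simp_all
qed

lemma monomial_order_add:
  assumes "monomial_order prec" "prec \<alpha> \<beta>"
  shows "prec (\<gamma> + \<alpha>) (\<gamma> + \<beta>)"
  using assms by (simp add: monomial_order_def add.commute)

lemma monomial_order_block_order:
  assumes "monomial_order prec" "monomial_order prec0"
  shows "monomial_order (block_order prec prec0)"
  unfolding monomial_order_def
proof (intro conjI allI impI)
  note * = assms[unfolded monomial_order_def]
  show "irreflp (block_order prec prec0)"
    using * by (auto simp: irreflp_def block_order_def)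
  show "transp (block_order prec prec0)"
    using * by (auto simp: block_order_def intro!: transpI dest: transpD)
  show "totalp (block_order prec prec0)"
    using * by (auto simp: block_order_def intro!: totalpI dest: totalpD)
  show "block_order prec prec0 (\<alpha> + \<gamma>) (\<beta> + \<gamma>)" if "block_order prec prec0 \<alpha> \<beta>" for \<alpha> \<beta> \<gamma>
    using that * by (cases \<alpha>; cases \<beta>; cases \<gamma>) (auto simp: block_order_def)
qed

text \<open>The block order is a lexicographic product of well-founded relations. This is the
  termination argument of the reduction.\<close>

lemma wfP_block_order:
  assumes "wfP prec" "wfP prec0"
  shows "wfP (block_order prec prec0)"
proof -
  have "{(x, y). block_order prec prec0 x y} = {(x, y). prec x y} <*lex*> {(x, y). prec0 x y}"
    by (auto simp: block_order_def)
  then show ?thesis using assms by (simp add: wfp_def wf_lex_prod)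
qed

lemma mpoly_supp_finite: "f \<in> carrier (mpoly_ring R) \<Longrightarrow> finite (mpoly_supp R f)"
  by (simp add: mpoly_carrier mpoly_supp_def)

lemma mpoly_supp_nonempty: "f \<noteq> \<zero>\<^bsub>mpoly_ring R\<^esub> \<Longrightarrow> mpoly_supp R f \<noteq> {}"
  by (auto simp: mpoly_zero mpoly_supp_def)

lemma
  assumes "monomial_order prec" "f \<in> carrier (mpoly_ring R)" "f \<noteq> \<zero>\<^bsub>mpoly_ring R\<^esub>"
  shows lead_coef_nonzero: "lead_coef R prec f \<noteq> \<zero>\<^bsub>R\<^esub>"
    and lead_exp_max: "f \<alpha> \<noteq> \<zero>\<^bsub>R\<^esub> \<Longrightarrow> \<alpha> \<noteq> max_exp prec (mpoly_supp R f) \<Longrightarrow>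
      prec \<alpha> (max_exp prec (mpoly_supp R f))"
  using max_exp_in[OF assms(1) mpoly_supp_finite[OF assms(2)] mpoly_supp_nonempty[OF assms(3)]]
    max_exp_max[OF assms(1) mpoly_supp_finite[OF assms(2)] mpoly_supp_nonempty[OF assms(3)]]
  by (auto simp: lead_coef_def mpoly_supp_def)

section \<open>Leading exponents in both groups of variables, and how reductions change them\<close>

lemma mpoly_supp2_finite:
  assumes "f \<in> carrier (mpoly_ring (mpoly_ring K))"
  shows "finite (mpoly_supp2 K f)"
proof (rule finite_subset)
  show "mpoly_supp2 K f \<subseteq> Sigma (mpoly_supp (mpoly_ring K) f) (\<lambda>\<alpha>. mpoly_supp K (f \<alpha>))"
    by (auto simp: mpoly_supp2_def mpoly_supp_def mpoly_zero)
  show "finite (Sigma (mpoly_supp (mpoly_ring K) f) (\<lambda>\<alpha>. mpoly_supp K (f \<alpha>)))"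
    by (intro finite_SigmaI mpoly_supp_finite assms mpoly_coeff_closed[OF assms])
qed

lemma mpoly_supp2_nonempty:
  "f \<noteq> \<zero>\<^bsub>mpoly_ring (mpoly_ring K)\<^esub> \<Longrightarrow> mpoly_supp2 K f \<noteq> {}"
  by (auto simp: mpoly_zero mpoly_supp2_def fun_eq_iff)

text \<open>The x-part is compared first, so the maximum is found in two stages. This splits
  divisibility of leading terms into a condition on x-exponents and one on the leading
  coefficients.\<close>

lemma max_exp_supp2:
  assumes "monomial_order prec" "monomial_order prec0"
    and f: "f \<in> carrier (mpoly_ring (mpoly_ring K))" "f \<noteq> \<zero>\<^bsub>mpoly_ring (mpoly_ring K)\<^esub>"
  shows "max_exp (block_order prec prec0) (mpoly_supp2 K f) =
    (max_exp prec (mpoly_supp (mpoly_ring K) f),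
     max_exp prec0 (mpoly_supp K (lead_coef (mpoly_ring K) prec f)))"
    (is "_ = (?\<alpha>, ?\<gamma>)")
proof (rule max_exp_eqI[OF monomial_order_block_order[OF assms(1,2)]])
  note lc = lead_coef_nonzero[OF assms(1) f]
  have lc_closed: "lead_coef (mpoly_ring K) prec f \<in> carrier (mpoly_ring K)"
    using f(1) by (simp add: lead_coef_def mpoly_coeff_closed)
  have "?\<gamma> \<in> mpoly_supp K (lead_coef (mpoly_ring K) prec f)"
    using assms(2) lc lc_closed by (intro max_exp_in mpoly_supp_finite mpoly_supp_nonempty)
  then show "(?\<alpha>, ?\<gamma>) \<in> mpoly_supp2 K f"
    by (simp add: mpoly_supp_def mpoly_supp2_def lead_coef_def)
  fix x assume "x \<in> mpoly_supp2 K f" "x \<noteq> (?\<alpha>, ?\<gamma>)"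
  then obtain \<alpha> \<gamma> where x: "x = (\<alpha>, \<gamma>)" "f \<alpha> \<gamma> \<noteq> \<zero>\<^bsub>K\<^esub>" "(\<alpha>, \<gamma>) \<noteq> (?\<alpha>, ?\<gamma>)"
    by (auto simp: mpoly_supp2_def)
  show "block_order prec prec0 x (?\<alpha>, ?\<gamma>)"
  proof (cases "\<alpha> = ?\<alpha>")
    case True
    then have "prec0 \<gamma> ?\<gamma>"
      using x lead_exp_max[OF assms(2) lc_closed lc] by (auto simp: lead_coef_def)
    then show ?thesis using True x by (simp add: block_order_def)
  next
    case False
    have "f \<alpha> \<noteq> \<zero>\<^bsub>mpoly_ring K\<^esub>" using x by (auto simp: mpoly_zero)
    then show ?thesis using False x lead_exp_max[OF assms(1) f] by (simp add: block_order_def)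
  qed
qed

context cring
begin

text \<open>A term shifts the support by \<beta>, and the order is compatible with the shift. Only
  an upper bound is claimed, so the coefficient at the bound may vanish. It is applied over the
  parameter ring, over K and over the residue field.\<close>

lemma mpoly_monom_mult_lead:
  assumes "monomial_order prec" and g: "g \<in> carrier (mpoly_ring R)" "g \<noteq> \<zero>\<^bsub>mpoly_ring R\<^esub>"
    and c: "c \<in> carrier R"
    and nz: "(mpoly_monom R \<beta> c \<otimes>\<^bsub>mpoly_ring R\<^esub> g) \<alpha> \<noteq> \<zero>"
    and ne: "\<alpha> \<noteq> \<beta> + max_exp prec (mpoly_supp R g)"
  shows "prec \<alpha> (\<beta> + max_exp prec (mpoly_supp R g))"
proof -
  obtain \<alpha>' where \<alpha>': "\<alpha> = \<beta> + \<alpha>'"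
    using mpoly_monom_mult_0[OF g(1)] nz by blast
  have "c \<otimes> g \<alpha>' \<noteq> \<zero>" using nz unfolding \<alpha>' mpoly_monom_mult[OF g(1) c] .
  then have "g \<alpha>' \<noteq> \<zero>" using c by auto
  moreover have "\<alpha>' \<noteq> max_exp prec (mpoly_supp R g)" using ne \<alpha>' by blast
  ultimately show ?thesis
    unfolding \<alpha>' by (intro monomial_order_add[OF assms(1)] lead_exp_max[OF assms(1) g])
qed

text \<open>The cancellation common to both reductions: it is used for the coefficients of x-terms
  and again for the parameter terms of one leading coefficient.\<close>

lemma mpoly_minus_cancel_lead:
  assumes f: "f \<in> carrier (mpoly_ring R)" and g: "g \<in> carrier (mpoly_ring R)"
    and "\<And>\<beta>. f \<beta> \<noteq> \<zero> \<Longrightarrow> \<beta> \<noteq> \<alpha> \<Longrightarrow> prec \<beta> \<alpha>"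
    and "\<And>\<beta>. g \<beta> \<noteq> \<zero> \<Longrightarrow> \<beta> \<noteq> \<alpha> \<Longrightarrow> prec \<beta> \<alpha>"
    and "f \<alpha> = g \<alpha>" and nz: "(f \<ominus>\<^bsub>mpoly_ring R\<^esub> g) \<beta> \<noteq> \<zero>"
  shows "prec \<beta> \<alpha>"
proof -
  have nz': "f \<beta> \<ominus> g \<beta> \<noteq> \<zero>" using nz by (simp only: mpoly_minus[OF f g] not_False_eq_True)
  have "\<beta> \<noteq> \<alpha>"
  proof
    assume "\<beta> = \<alpha>"
    then show False using nz' assms(5) mpoly_coeff_closed[OF g] by (simp add: a_minus_def r_neg)
  qed
  moreover have "f \<beta> \<noteq> \<zero> \<or> g \<beta> \<noteq> \<zero>"
  proof (rule ccontr)
    assume "\<not> ?thesis"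
    then show False using nz' by (simp add: a_minus_def)
  qed
  ultimately show ?thesis using assms(3)[of \<beta>] assms(4)[of \<beta>] by argo
qed

end

section \<open>Specialization\<close>

context ring_hom_cring
begin

lemma mpoly_map_hom:
  "(\<circ>) h \<in> ring_hom (mpoly_ring R :: (('n::finite \<Rightarrow>\<^sub>0 nat) \<Rightarrow> 'a) ring) (mpoly_ring S)"
proof (rule ring_hom_memI)
  fix f g :: "('n \<Rightarrow>\<^sub>0 nat) \<Rightarrow> 'a"
  assume f: "f \<in> carrier (mpoly_ring R)"
  then show "h \<circ> f \<in> carrier (mpoly_ring S)"
    by (auto simp: mpoly_carrier elim!: rev_finite_subset)
  assume g: "g \<in> carrier (mpoly_ring R)"
  show "h \<circ> (f \<oplus>\<^bsub>mpoly_ring R\<^esub> g) = (h \<circ> f) \<oplus>\<^bsub>mpoly_ring S\<^esub> (h \<circ> g)"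
    using f g by (auto simp: mpoly_coeff_closed)
  show "h \<circ> (f \<otimes>\<^bsub>mpoly_ring R\<^esub> g) = (h \<circ> f) \<otimes>\<^bsub>mpoly_ring S\<^esub> (h \<circ> g)"
  proof
    fix \<gamma>
    have "h (\<Oplus>p \<in> {p. fst p + snd p = \<gamma>}. f (fst p) \<otimes> g (snd p)) =
        (\<Oplus>\<^bsub>S\<^esub>p \<in> {p. fst p + snd p = \<gamma>}. h (f (fst p) \<otimes> g (snd p)))"
      using f g by (subst hom_finsum) (auto simp: mpoly_coeff_closed o_def)
    also have "\<dots> = (\<Oplus>\<^bsub>S\<^esub>p \<in> {p. fst p + snd p = \<gamma>}. h (f (fst p)) \<otimes>\<^bsub>S\<^esub> h (g (snd p)))"
      using f g by (intro S.finsum_cong') (auto simp: mpoly_coeff_closed)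
    finally show "(h \<circ> (f \<otimes>\<^bsub>mpoly_ring R\<^esub> g)) \<gamma> = ((h \<circ> f) \<otimes>\<^bsub>mpoly_ring S\<^esub> (h \<circ> g)) \<gamma>"
      by (simp add: mpoly_mult)
  qed
qed (auto simp: mpoly_one)

lemma mpoly_map_hom_cring: "ring_hom_cring (mpoly_ring R) (mpoly_ring S) ((\<circ>) h)"
  by (intro ring_hom_cring.intro R.mpoly_ring_cring S.mpoly_ring_cring
      ring_hom_cring_axioms.intro mpoly_map_hom)

lemma mpoly_map_const: "h \<circ> mpoly_const R c = mpoly_const S (h c)"
  by (auto simp: mpoly_const_def)

text \<open>Extension of an ideal to a localization, with \<open>U\<close> as the multiplicative
  set. The elements that reach the image of J after multiplication by some denominator form an ideal
  containing that image, hence containing the ideal it generates.\<close>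

lemma Idl_image_denominator:
  assumes J: "ideal J R" and U: "U \<subseteq> carrier R" "\<one> \<in> U"
    and U_mult: "\<And>u v. u \<in> U \<Longrightarrow> v \<in> U \<Longrightarrow> u \<otimes> v \<in> U"
    and den: "\<And>y. y \<in> carrier S \<Longrightarrow> \<exists>u\<in>U. \<exists>a\<in>carrier R. h u \<otimes>\<^bsub>S\<^esub> y = h a"
    and x: "x \<in> Idl\<^bsub>S\<^esub> (h ` J)"
  shows "x \<in> carrier S \<and> (\<exists>u\<in>U. \<exists>a\<in>J. h u \<otimes>\<^bsub>S\<^esub> x = h a)"
proof -
  interpret J: ideal J R by fact
  let ?I = "{x \<in> carrier S. \<exists>u\<in>U. \<exists>a\<in>J. h u \<otimes>\<^bsub>S\<^esub> x = h a}"
  have mult: "y \<otimes>\<^bsub>S\<^esub> x \<in> ?I" if xI: "x \<in> ?I" and y: "y \<in> carrier S" for x y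
  proof -
    obtain u a where ua: "u \<in> U" "a \<in> J" "h u \<otimes>\<^bsub>S\<^esub> x = h a" and xc: "x \<in> carrier S"
      using xI by blast
    obtain v b where vb: "v \<in> U" "b \<in> carrier R" "h v \<otimes>\<^bsub>S\<^esub> y = h b" using den[OF y] by blast
    have c: "u \<in> carrier R" "v \<in> carrier R" "a \<in> carrier R" using ua vb U by auto
    have "h (v \<otimes> u) \<otimes>\<^bsub>S\<^esub> (y \<otimes>\<^bsub>S\<^esub> x) = (h v \<otimes>\<^bsub>S\<^esub> y) \<otimes>\<^bsub>S\<^esub> (h u \<otimes>\<^bsub>S\<^esub> x)"
      using c y xc by (simp add: S.m_ac)
    also have "\<dots> = h (b \<otimes> a)" using ua vb c by simp
    finally show ?thesis using y xc ua vb U_mult J.I_l_closed by blast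
  qed
  have "ideal ?I S"
  proof (rule idealI)
    show "ring S" by (rule S.ring_axioms)
    show "subgroup ?I (add_monoid S)"
    proof (rule S.add.subgroupI)
      have "h \<one> \<otimes>\<^bsub>S\<^esub> \<zero>\<^bsub>S\<^esub> = h \<zero>" by simp
      then have "\<zero>\<^bsub>S\<^esub> \<in> ?I"
        using U(2) additive_subgroup.zero_closed[OF J.is_additive_subgroup] by blast
      then show "?I \<noteq> {}" by blast
      \<comment> \<open>Negation is multiplication by minus one, already covered by
        \<open>mult\<close>.\<close>
      show "\<ominus>\<^bsub>S\<^esub> x \<in> ?I" if "x \<in> ?I" for x
        using mult[OF that, of "\<ominus>\<^bsub>S\<^esub> \<one>\<^bsub>S\<^esub>"] that by (simp add: S.l_minus)
      show "x \<oplus>\<^bsub>S\<^esub> y \<in> ?I" if xI: "x \<in> ?I" and yI: "y \<in> ?I" for x y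
      proof -
        obtain u a where ua: "u \<in> U" "a \<in> J" "h u \<otimes>\<^bsub>S\<^esub> x = h a" and xc: "x \<in> carrier S"
          using xI by blast
        obtain v b where vb: "v \<in> U" "b \<in> J" "h v \<otimes>\<^bsub>S\<^esub> y = h b" and yc: "y \<in> carrier S"
          using yI by blast
        have c: "u \<in> carrier R" "v \<in> carrier R" "a \<in> carrier R" "b \<in> carrier R"
          using ua vb U by auto
        \<comment> \<open>The product of the two denominators serves as a common one.\<close>
        have "h (u \<otimes> v) \<otimes>\<^bsub>S\<^esub> (x \<oplus>\<^bsub>S\<^esub> y) =
            h v \<otimes>\<^bsub>S\<^esub> (h u \<otimes>\<^bsub>S\<^esub> x) \<oplus>\<^bsub>S\<^esub> h u \<otimes>\<^bsub>S\<^esub> (h v \<otimes>\<^bsub>S\<^esub> y)"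
          using c yc xc by (simp add: S.m_ac S.r_distr)
        also have "\<dots> = h (v \<otimes> a \<oplus> u \<otimes> b)" using ua vb c by simp
        finally show ?thesis using c yc xc ua vb U_mult J.I_l_closed J.a_closed by blast
      qed
    qed auto
    show "y \<otimes>\<^bsub>S\<^esub> x \<in> ?I" "x \<otimes>\<^bsub>S\<^esub> y \<in> ?I" if "x \<in> ?I" "y \<in> carrier S" for x y
      using mult[OF that] that by (simp_all add: S.m_comm)
  qed
  moreover have "h ` J \<subseteq> ?I"
  proof (rule image_subsetI)
    fix a assume a: "a \<in> J"
    then have "h \<one> \<otimes>\<^bsub>S\<^esub> h a = h a" by simp
    then show "h a \<in> ?I" using a U(2) hom_closed[OF J.Icarr[OF a]] by blast
  qed
  ultimately have "Idl\<^bsub>S\<^esub> (h ` J) \<subseteq> ?I" by (rule S.genideal_minimal)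
  then show ?thesis using x by blast
qed

end

section \<open>Descent along the block order\<close>

text \<open>The residue map enters only as a homomorphism \<phi> into a domain, and
  \<open>dichotomy\<close> records all that is needed about G and its kernel: the leading
  coefficient survives, or the element is a constant killed by \<phi>.\<close>

lemma groebner_descent:
  fixes K :: "('k, 'b) ring_scheme"
    and R :: "(('m::finite \<Rightarrow>\<^sub>0 nat) \<Rightarrow> 'k) ring"
    and A :: "(('n::finite \<Rightarrow>\<^sub>0 nat) \<Rightarrow> ('m \<Rightarrow>\<^sub>0 nat) \<Rightarrow> 'k) ring"
    and f :: "('n::finite \<Rightarrow>\<^sub>0 nat) \<Rightarrow> ('m \<Rightarrow>\<^sub>0 nat) \<Rightarrow> 'k"
  assumes "field K" and R: "R = mpoly_ring K" and A: "A = mpoly_ring R"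
    and prec0: "monomial_order prec0" "wfP prec0" and prec: "monomial_order prec" "wfP prec"
    and "domain F" and hom: "\<phi> \<in> ring_hom R F"
    and "ideal I A"
    and G: "groebner_basis A (mpoly_supp2 K) (block_order prec prec0) G I"
    and dichotomy: "\<And>g. g \<in> G \<Longrightarrow> \<phi> (lead_coef R prec g) \<noteq> \<zero>\<^bsub>F\<^esub> \<or>
      (\<exists>q\<in>carrier R. \<phi> q = \<zero>\<^bsub>F\<^esub> \<and> g = mpoly_const R q)"
    and "f \<in> I" "\<phi> \<circ> f \<noteq> \<zero>\<^bsub>mpoly_ring F\<^esub>"
  shows "\<exists>g\<in>G. \<phi> (lead_coef R prec g) \<noteq> \<zero>\<^bsub>F\<^esub> \<and>
    (\<exists>\<beta>. max_exp prec (mpoly_supp F (\<phi> \<circ> f)) = max_exp prec (mpoly_supp R g) + \<beta>)"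
proof -
  interpret K: field K by fact
  interpret R: cring R unfolding R by (rule K.mpoly_ring_cring)
  interpret A: cring A unfolding A by (rule R.mpoly_ring_cring)
  interpret F: domain F by fact
  interpret \<phi>: ring_hom_cring R F \<phi>
    by (intro ring_hom_cring.intro R.cring_axioms F.cring_axioms ring_hom_cring_axioms.intro hom)
  interpret I: ideal I A by fact
  let ?lead = "\<lambda>f. max_exp (block_order prec prec0) (mpoly_supp2 K f)"
  let ?lc = "lead_coef R prec" and ?le = "\<lambda>f. max_exp prec (mpoly_supp R f)"
  note block = monomial_order_block_order[OF prec(1) prec0(1)]
  note lead = max_exp_supp2[OF prec(1) prec0(1), where K = K, folded R A]
  have coeff_closed: "f \<alpha> \<in> carrier R" if "f \<in> carrier A" for f \<alpha>
    using that unfolding A by (rule mpoly_coeff_closed)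
  have lc_closed: "?lc f \<in> carrier R" if "f \<in> carrier A" for f
    using that by (simp add: lead_coef_def coeff_closed)
  have lc_nonzero: "?lc f \<noteq> \<zero>\<^bsub>R\<^esub>" if "f \<in> carrier A" "f \<noteq> \<zero>\<^bsub>A\<^esub>" for f
    using lead_coef_nonzero[OF prec(1)] that unfolding A .
  have supp_le: "prec \<alpha> (?le f)"
    if "f \<in> carrier A" "f \<noteq> \<zero>\<^bsub>A\<^esub>" "f \<alpha> \<noteq> \<zero>\<^bsub>R\<^esub>" "\<alpha> \<noteq> ?le f" for f \<alpha>
    using lead_exp_max[OF prec(1)] that unfolding A .
  \<comment> \<open>A nonzero f' has its leading exponent in its own support, so bounding the whole
    support below the old leading exponent is enough.\<close>
  have lead_less: "block_order prec prec0 (?lead f') (?lead f)"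
    if f: "f \<in> carrier A" "f \<noteq> \<zero>\<^bsub>A\<^esub>" and f': "f' \<in> carrier A" "f' \<noteq> \<zero>\<^bsub>A\<^esub>"
      and less: "\<And>\<alpha> \<gamma>. f' \<alpha> \<gamma> \<noteq> \<zero>\<^bsub>K\<^esub> \<Longrightarrow> block_order prec prec0 (\<alpha>, \<gamma>) (?lead f)" for f f'
  proof -
    have "?lead f' \<in> mpoly_supp2 K f'"
      using f' unfolding A R by (intro max_exp_in[OF block] mpoly_supp2_finite mpoly_supp2_nonempty)
    then show ?thesis using less by (cases "?lead f'") (simp add: mpoly_supp2_def)
  qed
  have wf: "wfP (block_order prec prec0)" using prec(2) prec0(2) by (rule wfP_block_order)
  \<comment> \<open>The induction is on the leading exponent with f left general, since each
    reduction replaces f by another element of \<open>I\<close>.\<close>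
  define P where "P \<equiv> \<lambda>l. \<forall>f. ?lead f = l \<longrightarrow> f \<in> I \<longrightarrow> \<phi> \<circ> f \<noteq> \<zero>\<^bsub>mpoly_ring F\<^esub> \<longrightarrow>
    (\<exists>g\<in>G. \<phi> (?lc g) \<noteq> \<zero>\<^bsub>F\<^esub> \<and>
      (\<exists>\<beta>. max_exp prec (mpoly_supp F (\<phi> \<circ> f)) = ?le g + \<beta>))"
  have "P l" for l
    using wf
  proof (induction l rule: wfp_induct_rule)
    case (less l)
    have IH: "\<exists>g\<in>G. \<phi> (?lc g) \<noteq> \<zero>\<^bsub>F\<^esub> \<and>
      (\<exists>\<beta>. max_exp prec (mpoly_supp F (\<phi> \<circ> f')) = ?le g + \<beta>)"
      if "block_order prec prec0 (?lead f') l" "f' \<in> I" "\<phi> \<circ> f' \<noteq> \<zero>\<^bsub>mpoly_ring F\<^esub>" for f'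
      using less[OF that(1)] that(2,3) unfolding P_def by blast
    show ?case
      unfolding P_def
    proof (intro allI impI)
      fix f assume l: "?lead f = l" and fI: "f \<in> I" and \<phi>f: "\<phi> \<circ> f \<noteq> \<zero>\<^bsub>mpoly_ring F\<^esub>"
      have nonzero: "f' \<noteq> \<zero>\<^bsub>A\<^esub>" if "\<phi> \<circ> f' \<noteq> \<zero>\<^bsub>mpoly_ring F\<^esub>" for f'
        using that by (auto simp: A mpoly_zero)
      have f: "f \<in> carrier A" "f \<noteq> \<zero>\<^bsub>A\<^esub>" using I.Icarr[OF fI] nonzero[OF \<phi>f] by auto
      have "?lead f \<in> (\<Union>g\<in>G. {?lead g + \<beta> | \<beta>. True})"
        using G f(2) fI unfolding groebner_basis_def by blast
      then obtain g p where gG: "g \<in> G" and p: "?lead f = ?lead g + p" by blast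
      have gI: "g \<in> I" and g: "g \<in> carrier A" "g \<noteq> \<zero>\<^bsub>A\<^esub>"
        using gG G I.Icarr unfolding groebner_basis_def by auto
      \<comment> \<open>The cofactor splits: \<beta> moves the x-exponent of g to that of f, and
        \<delta> moves the leading parameter exponent of lc(g) to that of lc(f). The
        pseudo-reduction uses \<beta>, the reduction by a constant uses \<delta>.\<close>
      obtain \<beta> \<delta> where "p = (\<beta>, \<delta>)" by (cases p)
      with p have \<alpha>: "?le f = \<beta> + ?le g"
        and \<gamma>: "max_exp prec0 (mpoly_supp K (?lc f)) = \<delta> + max_exp prec0 (mpoly_supp K (?lc g))"
        by (simp_all add: lead[OF f] lead[OF g] add.commute)
      show "\<exists>g\<in>G. \<phi> (?lc g) \<noteq> \<zero>\<^bsub>F\<^esub> \<and>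
          (\<exists>\<beta>. max_exp prec (mpoly_supp F (\<phi> \<circ> f)) = ?le g + \<beta>)"
      proof (cases "\<phi> (?lc g) = \<zero>\<^bsub>F\<^esub>")
        case False
        note lcg = False
        show ?thesis
        proof (cases "\<phi> (?lc f) = \<zero>\<^bsub>F\<^esub>")
          case False
          \<comment> \<open>Specializing creates no new exponents, and the coefficient at the top
            one survives.\<close>
          have "max_exp prec (mpoly_supp F (\<phi> \<circ> f)) = ?le f"
          proof (rule max_exp_eqI[OF prec(1)])
            show "?le f \<in> mpoly_supp F (\<phi> \<circ> f)"
              using False by (simp add: mpoly_supp_def lead_coef_def)
            fix \<beta> assume "\<beta> \<in> mpoly_supp F (\<phi> \<circ> f)" "\<beta> \<noteq> ?le f"
            then show "prec \<beta> (?le f)"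
              by (intro supp_le[OF f]) (auto simp: mpoly_supp_def)
          qed
          then show ?thesis
            using gG lcg \<alpha> by (intro bexI[of _ g]) (auto simp: add.commute)
        next
          case True
          \<comment> \<open>lc(g) need not be invertible in R, so f is scaled by it, and g is scaled
            by lc(f) to match.\<close>
          define u where "u = mpoly_const R (?lc g) \<otimes>\<^bsub>A\<^esub> f"
          define v where "v = mpoly_monom R \<beta> (?lc f) \<otimes>\<^bsub>A\<^esub> g"
          let ?f' = "u \<ominus>\<^bsub>A\<^esub> v"
          have cm: "mpoly_const R (?lc g) \<in> carrier A" "mpoly_monom R \<beta> (?lc f) \<in> carrier A"
            using f g by (simp_all add: A R.mpoly_const_eq_monom R.mpoly_monom_closed lc_closed[unfolded A])
          have u: "u \<alpha> = ?lc g \<otimes>\<^bsub>R\<^esub> f \<alpha>" for \<alpha>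
            using R.mpoly_const_mult[of f "?lc g" \<alpha>] f g lc_closed[of g] unfolding u_def A by simp
          have v: "v (\<beta> + \<alpha>) = ?lc f \<otimes>\<^bsub>R\<^esub> g \<alpha>" for \<alpha>
            using R.mpoly_monom_mult[of g "?lc f" \<beta> \<alpha>] f g lc_closed[of f] unfolding v_def A by simp
          have uI: "u \<in> I" and vI: "v \<in> I"
            using fI gI cm unfolding u_def v_def by (auto intro: I.I_l_closed)
          then have f'I: "?f' \<in> I" by (simp add: a_minus_def I.a_inv_closed I.a_closed)
          have uA: "u \<in> carrier A" and vA: "v \<in> carrier A" using uI vI by (auto dest: I.Icarr)
          \<comment> \<open>Each coefficient of v is zero or a multiple of lc(f), which \<phi> kills
            in this case.\<close>
          have \<phi>v: "\<phi> (v \<alpha>) = \<zero>\<^bsub>F\<^esub>" for \<alpha>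
          proof (cases "\<exists>\<alpha>'. \<alpha> = \<beta> + \<alpha>'")
            case ex: True
            then show ?thesis using f g True by (auto simp: v lc_closed coeff_closed)
          next
            case False
            then have "v \<alpha> = \<zero>\<^bsub>R\<^esub>"
              unfolding v_def A using g[unfolded A] by (intro R.mpoly_monom_mult_0) auto
            then show ?thesis by simp
          qed
          have \<phi>f': "\<phi> (?f' \<alpha>) = \<phi> (?lc g) \<otimes>\<^bsub>F\<^esub> \<phi> (f \<alpha>)" for \<alpha>
            using coeff_closed[OF vA, of \<alpha>] coeff_closed[OF f(1), of \<alpha>] lc_closed[OF g(1)]
            unfolding A R.mpoly_minus[OF uA[unfolded A] vA[unfolded A]] u
            by (simp add: a_minus_def \<phi>v)
          have supp: "mpoly_supp F (\<phi> \<circ> ?f') = mpoly_supp F (\<phi> \<circ> f)"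
            using lcg coeff_closed[OF f(1)] lc_closed[OF g(1)]
            by (simp add: mpoly_supp_def \<phi>f' F.integral_iff)
          have \<phi>f'_nz: "\<phi> \<circ> ?f' \<noteq> \<zero>\<^bsub>mpoly_ring F\<^esub>"
          proof
            assume "\<phi> \<circ> ?f' = \<zero>\<^bsub>mpoly_ring F\<^esub>"
            then have "mpoly_supp F (\<phi> \<circ> f) = {}"
              unfolding supp[symmetric] by (simp add: mpoly_supp_def mpoly_zero)
            with \<phi>f show False by (auto simp: mpoly_supp_def mpoly_zero)
          qed
          have "block_order prec prec0 (?lead ?f') (?lead f)"
          proof (rule lead_less[OF f I.Icarr[OF f'I] nonzero[OF \<phi>f'_nz]])
            fix \<alpha> \<gamma> assume "?f' \<alpha> \<gamma> \<noteq> \<zero>\<^bsub>K\<^esub>"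
            then have nz: "?f' \<alpha> \<noteq> \<zero>\<^bsub>R\<^esub>" by (auto simp: R mpoly_zero)
            \<comment> \<open>The coefficient at the leading x-exponent cancels completely, so all
              remaining x-exponents are strictly smaller. The parameter exponent \<gamma> is left
              uncontrolled: multiplication by lc(g) may have raised it.\<close>
            have "prec \<alpha> (?le f)"
            proof (rule R.mpoly_minus_cancel_lead[OF uA[unfolded A] vA[unfolded A]])
              show "(u \<ominus>\<^bsub>mpoly_ring R\<^esub> v) \<alpha> \<noteq> \<zero>\<^bsub>R\<^esub>" using nz unfolding A .
              show "u (?le f) = v (?le f)"
                using lc_closed[OF f(1)] lc_closed[OF g(1)]
                by (simp add: u \<alpha> v lead_coef_def R.m_comm)
              show "prec \<beta>' (?le f)" if "u \<beta>' \<noteq> \<zero>\<^bsub>R\<^esub>" "\<beta>' \<noteq> ?le f" for \<beta>'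
                using that f lc_closed[OF g(1)] by (intro supp_le) (auto simp: u)
              show "prec \<beta>' (?le f)" if "v \<beta>' \<noteq> \<zero>\<^bsub>R\<^esub>" "\<beta>' \<noteq> ?le f" for \<beta>'
                using R.mpoly_monom_mult_lead[OF prec(1) g[unfolded A] lc_closed[OF f(1)], of \<beta> \<beta>']
                  that unfolding \<alpha> v_def A by blast
            qed
            then show "block_order prec prec0 (\<alpha>, \<gamma>) (?lead f)"
              unfolding lead[OF f] by (simp add: block_order_def)
          qed
          then show ?thesis using IH[OF _ f'I \<phi>f'_nz] unfolding supp l by blast
        qed
      next
        case True
        \<comment> \<open>The dichotomy makes g a constant polynomial, so its x-exponent is 0 and
          its leading coefficient is q.\<close>
        then obtain q where q: "q \<in> carrier R" "\<phi> q = \<zero>\<^bsub>F\<^esub>" "g = mpoly_const R q"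
          using dichotomy[OF gG] by blast
        have q0: "q \<noteq> \<zero>\<^bsub>R\<^esub>" using g(2) q(3) by (auto simp: A mpoly_zero mpoly_const_def)
        then have "mpoly_supp R g = {0}" by (auto simp: q(3) mpoly_supp_def mpoly_const_def)
        then have leg: "?le g = 0"
          by (intro max_exp_eqI[OF prec(1)]) auto
        then have lcg: "?lc g = q" by (simp add: lead_coef_def q(3) mpoly_const_def)
        define \<epsilon> where "\<epsilon> = max_exp prec0 (mpoly_supp K q)"
        have q\<epsilon>: "q \<epsilon> \<in> carrier K" "q \<epsilon> \<noteq> \<zero>\<^bsub>K\<^esub>"
          using q(1) q0 mpoly_coeff_closed[of q K] lead_coef_nonzero[OF prec0(1), of q K]
          by (simp_all add: R \<epsilon>_def lead_coef_def)
        have qinv: "inv\<^bsub>K\<^esub> (q \<epsilon>) \<in> carrier K" "inv\<^bsub>K\<^esub> (q \<epsilon>) \<otimes>\<^bsub>K\<^esub> q \<epsilon> = \<one>\<^bsub>K\<^esub>"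
          using q\<epsilon> K.field_Units by auto
        \<comment> \<open>The quotient of the leading coefficients in K. As \<delta> + \<epsilon> is
          the leading parameter exponent of lc(f), the product of q and the term t with exponent
          \<delta> and coefficient c has the same leading term as lc(f).\<close>
        define c where "c = ?lc f (\<delta> + \<epsilon>) \<otimes>\<^bsub>K\<^esub> inv\<^bsub>K\<^esub> (q \<epsilon>)"
        define t where "t = mpoly_monom K \<delta> c"
        have lcf: "?lc f \<in> carrier R" "?lc f \<noteq> \<zero>\<^bsub>R\<^esub>" using f lc_closed lc_nonzero by auto
        have lcfK': "?lc f \<in> carrier (mpoly_ring K)" "?lc f \<noteq> \<zero>\<^bsub>mpoly_ring K\<^esub>"
          using lcf unfolding R by simp_all
        have lcfK: "?lc f \<gamma> \<in> carrier K" for \<gamma> using lcf(1) unfolding R by (rule mpoly_coeff_closed)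
        have cK: "c \<in> carrier K" using lcfK qinv by (simp add: c_def)
        have tR: "t \<in> carrier R" unfolding t_def R by (rule K.mpoly_monom_closed[OF cK])
        \<comment> \<open>Since g is constant in x, this multiple lives at the leading x-exponent of
          f only, so the subtraction changes no other coefficient of f.\<close>
        define v where "v = mpoly_monom R (?le f) t \<otimes>\<^bsub>A\<^esub> g"
        let ?f' = "f \<ominus>\<^bsub>A\<^esub> v"
        have vI: "v \<in> I"
          unfolding v_def using gI R.mpoly_monom_closed[OF tR] by (intro I.I_l_closed) (simp_all add: A)
        then have f'I: "?f' \<in> I" using fI by (simp add: a_minus_def I.a_inv_closed I.a_closed)
        have vA: "v \<in> carrier A" using vI by (rule I.Icarr)
        have v: "v \<alpha> = (if \<alpha> = ?le f then t \<otimes>\<^bsub>R\<^esub> q else \<zero>\<^bsub>R\<^esub>)" for \<alpha>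
        proof (cases "\<exists>\<alpha>'. \<alpha> = ?le f + \<alpha>'")
          case True
          then obtain \<alpha>' where \<alpha>': "\<alpha> = ?le f + \<alpha>'" by blast
          have "v \<alpha> = t \<otimes>\<^bsub>R\<^esub> g \<alpha>'"
            unfolding v_def A \<alpha>' using g[unfolded A] tR by (intro R.mpoly_monom_mult)
          then show ?thesis using tR by (simp add: \<alpha>' q(3) mpoly_const_def)
        next
          case False
          then have "v \<alpha> = \<zero>\<^bsub>R\<^esub>"
            unfolding v_def A using g[unfolded A] by (intro R.mpoly_monom_mult_0) auto
          moreover have "\<alpha> \<noteq> ?le f" using False by (metis add.right_neutral)
          ultimately show ?thesis by simp
        qed
        have f': "?f' \<alpha> = (if \<alpha> = ?le f then ?lc f \<ominus>\<^bsub>R\<^esub> t \<otimes>\<^bsub>R\<^esub> q else f \<alpha>)" for \<alpha>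
          using coeff_closed[OF f(1), of \<alpha>]
          unfolding A R.mpoly_minus[OF f(1)[unfolded A] vA[unfolded A]] v
          by (auto simp: lead_coef_def a_minus_def)
        \<comment> \<open>Only a multiple of q was subtracted, so the specialization stays literally
          the same and not just its support.\<close>
        have \<phi>f': "\<phi> \<circ> ?f' = \<phi> \<circ> f"
        proof
          fix \<alpha>
          have "\<phi> (?lc f \<ominus>\<^bsub>R\<^esub> t \<otimes>\<^bsub>R\<^esub> q) = \<phi> (?lc f)"
            using lcf(1) tR q(1,2) by (simp add: a_minus_def)
          then show "(\<phi> \<circ> ?f') \<alpha> = (\<phi> \<circ> f) \<alpha>"
            by (simp add: f' lead_coef_def)
        qed
        have \<phi>f'_nz: "\<phi> \<circ> ?f' \<noteq> \<zero>\<^bsub>mpoly_ring F\<^esub>" using \<phi>f unfolding \<phi>f' .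
        have tq: "t \<otimes>\<^bsub>R\<^esub> q \<in> carrier R" using tR q(1) by simp
        have "block_order prec prec0 (?lead ?f') (?lead f)"
        proof (rule lead_less[OF f I.Icarr[OF f'I] nonzero[OF \<phi>f'_nz]])
          fix \<alpha> \<gamma> assume nz: "?f' \<alpha> \<gamma> \<noteq> \<zero>\<^bsub>K\<^esub>"
          show "block_order prec prec0 (\<alpha>, \<gamma>) (?lead f)"
          \<comment> \<open>Elsewhere the x-exponent is already smaller; at the leading x-exponent
            the descent takes place in the parameters.\<close>
          proof (cases "\<alpha> = ?le f")
            case False
            then have "f \<alpha> \<noteq> \<zero>\<^bsub>R\<^esub>" using nz by (auto simp: f' R mpoly_zero)
            then show ?thesis
              using supp_le[OF f] False unfolding lead[OF f] by (simp add: block_order_def)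
          next
            case True
            have lf: "max_exp prec0 (mpoly_supp K (?lc f)) = \<delta> + \<epsilon>"
              using \<gamma> by (simp add: lcg \<epsilon>_def)
            have "prec0 \<gamma> (\<delta> + \<epsilon>)"
            proof (rule K.mpoly_minus_cancel_lead[OF lcfK'(1) tq[unfolded R]])
              show "(?lc f \<ominus>\<^bsub>mpoly_ring K\<^esub> t \<otimes>\<^bsub>mpoly_ring K\<^esub> q) \<gamma> \<noteq> \<zero>\<^bsub>K\<^esub>"
                using nz True by (simp add: f' R)
              have "(t \<otimes>\<^bsub>mpoly_ring K\<^esub> q) (\<delta> + \<epsilon>) = c \<otimes>\<^bsub>K\<^esub> q \<epsilon>"
                unfolding t_def using q(1)[unfolded R] cK by (intro K.mpoly_monom_mult)
              also have "\<dots> = ?lc f (\<delta> + \<epsilon>)"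
                using lcfK q\<epsilon> qinv by (simp add: c_def K.m_assoc)
              finally show "?lc f (\<delta> + \<epsilon>) = (t \<otimes>\<^bsub>mpoly_ring K\<^esub> q) (\<delta> + \<epsilon>)" ..
              show "prec0 \<eta> (\<delta> + \<epsilon>)" if "?lc f \<eta> \<noteq> \<zero>\<^bsub>K\<^esub>" "\<eta> \<noteq> \<delta> + \<epsilon>" for \<eta>
                using lead_exp_max[OF prec0(1) lcfK'] that unfolding lf .
              show "prec0 \<eta> (\<delta> + \<epsilon>)"
                if "(t \<otimes>\<^bsub>mpoly_ring K\<^esub> q) \<eta> \<noteq> \<zero>\<^bsub>K\<^esub>" "\<eta> \<noteq> \<delta> + \<epsilon>" for \<eta>
                using K.mpoly_monom_mult_lead[OF prec0(1) q(1)[unfolded R] q0[unfolded R] cK] that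
                unfolding t_def \<epsilon>_def .
            qed
            then show ?thesis using True unfolding lead[OF f] lf by (simp add: block_order_def)
          qed
        qed
        then show ?thesis using IH[OF _ f'I \<phi>f'_nz] unfolding \<phi>f' l by blast
      qed
    qed
  qed
  then show ?thesis using assms unfolding P_def by blast
qed

section \<open>Clearing denominators over the residue field\<close>

lemma (in primeideal) specialization_denominator:
  fixes H :: "('n::finite \<Rightarrow>\<^sub>0 nat) \<Rightarrow> _"
  assumes H: "H \<in> carrier (mpoly_ring (residue_field R I))"
  shows "\<exists>s\<in>carrier R - I. \<exists>f\<in>carrier (mpoly_ring R).
    mpoly_const (residue_field R I) (residue_map R I s) \<otimes>\<^bsub>mpoly_ring (residue_field R I)\<^esub> H =
      residue_map R I \<circ> f"
proof -
  let ?F = "residue_field R I" and ?\<phi> = "residue_map R I"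
  interpret F: domain ?F by (rule residue_field_domain)
  interpret \<phi>: ring_hom_cring R ?F ?\<phi>
    by (intro ring_hom_cring.intro is_cring F.cring_axioms ring_hom_cring_axioms.intro residue_map_hom)
  have coeff: "H \<alpha> \<in> carrier ?F" for \<alpha> using H by (rule mpoly_coeff_closed)
  \<comment> \<open>One denominator for a finite set of exponents: each new exponent multiplies s by
    its own denominator, and primality keeps the product outside I.\<close>
  have "\<exists>s\<in>carrier R - I. \<forall>\<alpha>\<in>S. \<exists>r\<in>carrier R. ?\<phi> s \<otimes>\<^bsub>?F\<^esub> H \<alpha> = ?\<phi> r" if "finite S" for S
    using that
  proof (induction S)
    case empty
    have "\<one> \<notin> I" using I_notcarr one_imp_carrier by blast
    then show ?case by auto
  next
    case (insert \<alpha> S)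
    then obtain s where s: "s \<in> carrier R - I"
      "\<And>\<alpha>. \<alpha> \<in> S \<Longrightarrow> \<exists>r\<in>carrier R. ?\<phi> s \<otimes>\<^bsub>?F\<^esub> H \<alpha> = ?\<phi> r" by blast
    obtain r' s' where s': "r' \<in> carrier R" "s' \<in> carrier R - I" "?\<phi> s' \<otimes>\<^bsub>?F\<^esub> H \<alpha> = ?\<phi> r'"
      using residue_field_denominator[OF coeff] by blast
    have "s' \<otimes> s \<in> carrier R - I" using s(1) s'(2) I_prime[of s' s] by auto
    moreover have "\<exists>r\<in>carrier R. ?\<phi> (s' \<otimes> s) \<otimes>\<^bsub>?F\<^esub> H \<beta> = ?\<phi> r" if "\<beta> \<in> insert \<alpha> S" for \<beta>
    proof (cases "\<beta> = \<alpha>")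
      case True
      have "?\<phi> (s' \<otimes> s) \<otimes>\<^bsub>?F\<^esub> H \<alpha> = ?\<phi> s \<otimes>\<^bsub>?F\<^esub> (?\<phi> s' \<otimes>\<^bsub>?F\<^esub> H \<alpha>)"
        using s(1) s'(1,2) coeff[of \<alpha>] by (simp add: F.m_ac)
      also have "\<dots> = ?\<phi> (s \<otimes> r')" using s s' by simp
      finally show ?thesis using True s s' by blast
    next
      case False
      then have "\<beta> \<in> S" using that by blast
      then obtain r where r: "r \<in> carrier R" "?\<phi> s \<otimes>\<^bsub>?F\<^esub> H \<beta> = ?\<phi> r" using s(2) by blast
      have "?\<phi> (s' \<otimes> s) \<otimes>\<^bsub>?F\<^esub> H \<beta> = ?\<phi> s' \<otimes>\<^bsub>?F\<^esub> (?\<phi> s \<otimes>\<^bsub>?F\<^esub> H \<beta>)"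
        using s(1) s'(1,2) coeff[of \<beta>] by (simp add: F.m_assoc)
      also have "\<dots> = ?\<phi> (s' \<otimes> r)" using s' r by simp
      finally show ?thesis using s' r by blast
    qed
    ultimately show ?case by blast
  qed
  then obtain s where s: "s \<in> carrier R - I"
    "\<forall>\<alpha>\<in>mpoly_supp ?F H. \<exists>r\<in>carrier R. ?\<phi> s \<otimes>\<^bsub>?F\<^esub> H \<alpha> = ?\<phi> r"
    using mpoly_supp_finite[OF H] by blast
  then obtain r where r: "\<And>\<alpha>. \<alpha> \<in> mpoly_supp ?F H \<Longrightarrow>
      r \<alpha> \<in> carrier R \<and> ?\<phi> s \<otimes>\<^bsub>?F\<^esub> H \<alpha> = ?\<phi> (r \<alpha>)"
    by metis
  \<comment> \<open>The lifts are chosen on the support of H only; zero elsewhere keeps the support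
    of f finite.\<close>
  define f where "f \<alpha> = (if \<alpha> \<in> mpoly_supp ?F H then r \<alpha> else \<zero>)" for \<alpha>
  have "{\<alpha>. f \<alpha> \<noteq> \<zero>} \<subseteq> mpoly_supp ?F H" by (auto simp: f_def)
  then have "finite {\<alpha>. f \<alpha> \<noteq> \<zero>}" by (rule finite_subset) (rule mpoly_supp_finite[OF H])
  then have "f \<in> carrier (mpoly_ring R)" using r by (simp add: mpoly_carrier f_def)
  moreover have "mpoly_const ?F (?\<phi> s) \<otimes>\<^bsub>mpoly_ring ?F\<^esub> H = ?\<phi> \<circ> f"
  proof
    fix \<alpha>
    have "?\<phi> s \<otimes>\<^bsub>?F\<^esub> H \<alpha> = ?\<phi> (f \<alpha>)"
      using r s by (cases "\<alpha> \<in> mpoly_supp ?F H") (simp_all add: f_def mpoly_supp_def)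
    then show "(mpoly_const ?F (?\<phi> s) \<otimes>\<^bsub>mpoly_ring ?F\<^esub> H) \<alpha> = (?\<phi> \<circ> f) \<alpha>"
      using s(1) H by (simp add: F.mpoly_const_mult)
  qed
  ultimately show ?thesis using s(1) by blast
qed

text \<open>An instance of the localization argument whose denominators are the constants outside
  the prime ideal. A constant denominator gives the relation between X and f coefficient by
  coefficient, so their supports can be compared.\<close>

lemma (in primeideal) specialize_ideal_denominator:
  fixes J :: "(('n::finite \<Rightarrow>\<^sub>0 nat) \<Rightarrow> _) set"
  assumes J: "ideal J (mpoly_ring R)" and X: "X \<in> specialize_ideal R I J"
  obtains s f where "s \<in> carrier R - I" "f \<in> J" "X \<in> carrier (mpoly_ring (residue_field R I))"
    "\<And>\<alpha>. residue_map R I s \<otimes>\<^bsub>residue_field R I\<^esub> X \<alpha> = residue_map R I (f \<alpha>)"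
proof -
  let ?F = "residue_field R I" and ?\<phi> = "residue_map R I"
  interpret F: domain ?F by (rule residue_field_domain)
  interpret \<phi>: ring_hom_cring R ?F ?\<phi>
    by (intro ring_hom_cring.intro is_cring F.cring_axioms ring_hom_cring_axioms.intro residue_map_hom)
  interpret \<Phi>: ring_hom_cring "mpoly_ring R" "mpoly_ring ?F" "(\<circ>) ?\<phi>"
    by (rule \<phi>.mpoly_map_hom_cring)
  let ?U = "mpoly_const R ` (carrier R - I) :: (('n \<Rightarrow>\<^sub>0 nat) \<Rightarrow> _) set"
  have spec: "specialize R I = (\<circ>) ?\<phi>" by (auto simp: specialize_def fun_eq_iff)
  have const: "mpoly_const R s \<in> carrier (mpoly_ring R)" if "s \<in> carrier R" for s
    using that by (simp add: mpoly_const_eq_monom mpoly_monom_closed)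
  have "X \<in> carrier (mpoly_ring ?F) \<and>
    (\<exists>u\<in>?U. \<exists>f\<in>J. (?\<phi> \<circ> u) \<otimes>\<^bsub>mpoly_ring ?F\<^esub> X = ?\<phi> \<circ> f)"
  proof (rule \<Phi>.Idl_image_denominator[OF J])
    show "?U \<subseteq> carrier (mpoly_ring R)" using const by auto
    have "\<one> \<notin> I" using I_notcarr one_imp_carrier by blast
    moreover have "\<one>\<^bsub>mpoly_ring R\<^esub> = mpoly_const R \<one>" by (simp add: mpoly_one mpoly_const_def)
    ultimately show "\<one>\<^bsub>mpoly_ring R\<^esub> \<in> ?U" by auto
    show "u \<otimes>\<^bsub>mpoly_ring R\<^esub> v \<in> ?U" if u: "u \<in> ?U" and v: "v \<in> ?U" for u v
    proof -
      obtain s t where st: "s \<in> carrier R - I" "u = mpoly_const R s"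
        "t \<in> carrier R - I" "v = mpoly_const R t" using u v by blast
      have "u \<otimes>\<^bsub>mpoly_ring R\<^esub> v = mpoly_const R (s \<otimes> t)"
      proof -
        have "(mpoly_const R s \<otimes>\<^bsub>mpoly_ring R\<^esub> mpoly_const R t) \<alpha> = mpoly_const R (s \<otimes> t) \<alpha>"
          for \<alpha> :: "'n \<Rightarrow>\<^sub>0 nat"
          using st(1,3) by (subst mpoly_const_mult) (auto simp: const, simp add: mpoly_const_def)
        then show ?thesis unfolding st(2,4) by (rule ext)
      qed
      moreover have "s \<otimes> t \<in> carrier R - I" using st I_prime[of s t] by auto
      ultimately show ?thesis by blast
    qed
    show "\<exists>u\<in>?U. \<exists>f\<in>carrier (mpoly_ring R). (?\<phi> \<circ> u) \<otimes>\<^bsub>mpoly_ring ?F\<^esub> H = ?\<phi> \<circ> f"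
      if "H \<in> carrier (mpoly_ring ?F)" for H
      using specialization_denominator[OF that] by (auto simp: \<phi>.mpoly_map_const)
    show "X \<in> Idl\<^bsub>mpoly_ring ?F\<^esub> ((\<circ>) ?\<phi> ` J)"
      using X by (simp add: specialize_ideal_def spec)
  qed
  then obtain s f where *: "s \<in> carrier R - I" "f \<in> J" "X \<in> carrier (mpoly_ring ?F)"
    "mpoly_const ?F (?\<phi> s) \<otimes>\<^bsub>mpoly_ring ?F\<^esub> X = ?\<phi> \<circ> f"
    by (auto simp: \<phi>.mpoly_map_const)
  then have "?\<phi> s \<otimes>\<^bsub>?F\<^esub> X \<alpha> = ?\<phi> (f \<alpha>)" for \<alpha>
    using F.mpoly_const_mult[of X "?\<phi> s" \<alpha>] by simp
  with * show thesis using that by blast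
qed

section \<open>Specialization of the Groebner basis\<close>

text \<open>Used in contrapositive form: if the product h avoids P, then so does each of its
  factors.\<close>

lemma (in ideal) finprod_in_ideal:
  assumes "cring R" "finite S" "x \<in> S" "f \<in> S \<rightarrow> carrier R" "f x \<in> I"
  shows "finprod R f S \<in> I"
proof -
  interpret cring R by fact
  have S: "insert x (S - {x}) = S" using assms(3) by blast
  have "finprod R f (insert x (S - {x})) = f x \<otimes> finprod R f (S - {x})"
    using assms by (intro finprod_insert) auto
  moreover have "finprod R f (S - {x}) \<in> carrier R" using assms by (intro finprod_closed) auto
  ultimately have "finprod R f (insert x (S - {x})) \<in> I" using assms(5) I_r_closed by simp
  then show ?thesis unfolding S .
qed

lemma set_add_memE:
  assumes "x \<in> H <+>\<^bsub>G\<^esub> L"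
  obtains h l where "h \<in> H" "l \<in> L" "x = h \<oplus>\<^bsub>G\<^esub> l"
  using assms by (auto simp: set_add_def')

theorem proposition3p1p3:
  fixes K :: "('k, 'b) ring_scheme"
    and R :: "(('m::finite \<Rightarrow>\<^sub>0 nat) \<Rightarrow> 'k) ring"
    and A :: "(('n::finite \<Rightarrow>\<^sub>0 nat) \<Rightarrow> ('m \<Rightarrow>\<^sub>0 nat) \<Rightarrow> 'k) ring"
    and prec0 :: "('m \<Rightarrow>\<^sub>0 nat) \<Rightarrow> ('m \<Rightarrow>\<^sub>0 nat) \<Rightarrow> bool"
    and prec :: "('n \<Rightarrow>\<^sub>0 nat) \<Rightarrow> ('n \<Rightarrow>\<^sub>0 nat) \<Rightarrow> bool"
    and J Jt G Gc :: "(('n \<Rightarrow>\<^sub>0 nat) \<Rightarrow> ('m \<Rightarrow>\<^sub>0 nat) \<Rightarrow> 'k) set"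
    and P Q :: "(('m \<Rightarrow>\<^sub>0 nat) \<Rightarrow> 'k) set"
    and h :: "('m \<Rightarrow>\<^sub>0 nat) \<Rightarrow> 'k"
  assumes "field K"
    and R: "R = mpoly_ring K"
    and A: "A = mpoly_ring R"
    and "monomial_order prec0" and "wfP prec0"
    and "monomial_order prec" and "wfP prec"
    and "ideal J A"
    and "primeideal Q R"
    and Jt: "Jt = J <+>\<^bsub>A\<^esub> Idl\<^bsub>A\<^esub> (mpoly_const R ` Q)"
    and "minimal_groebner_basis A (mpoly_supp2 K) (block_order prec prec0) G Jt"
    and Gc: "Gc = G - mpoly_const R ` Q"
    and h: "h = (\<Otimes>\<^bsub>R\<^esub>g\<in>Gc. lead_coef R prec g)"
    and "P \<in> zero_locus R Q - zero_locus R (PIdl\<^bsub>R\<^esub> h)"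
  shows "groebner_basis (mpoly_ring (residue_field R P)) (mpoly_supp (residue_field R P)) prec
    (specialize R P ` Gc) (specialize_ideal R P J)"
proof -
  let ?F = "residue_field R P" and ?\<phi> = "residue_map R P"
  let ?B = "mpoly_ring ?F" and ?lc = "lead_coef R prec"
  let ?le = "\<lambda>f. max_exp prec (mpoly_supp R f)" and ?leF = "\<lambda>f. max_exp prec (mpoly_supp ?F f)"
  interpret Q: primeideal Q R by fact
  interpret P: primeideal P R using assms(14) by (simp add: zero_locus_def)
  have QP: "Q \<subseteq> P" using assms(14) by (simp add: zero_locus_def)
  interpret F: domain ?F by (rule P.residue_field_domain)
  interpret \<phi>: ring_hom_cring R ?F ?\<phi>
    by (intro ring_hom_cring.intro Q.cring_axioms F.cring_axioms ring_hom_cring_axioms.intro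
        P.residue_map_hom)
  interpret \<Phi>: ring_hom_cring A ?B "(\<circ>) ?\<phi>"
    unfolding A by (rule \<phi>.mpoly_map_hom_cring)
  interpret J: ideal J A by fact
  have spec: "specialize R P = (\<circ>) ?\<phi>" by (auto simp: specialize_def fun_eq_iff)
  have coeff_closed: "f \<alpha> \<in> carrier R" if "f \<in> carrier A" for f \<alpha>
    using that unfolding A by (rule mpoly_coeff_closed)
  have constQ: "mpoly_const R ` Q \<subseteq> carrier A"
    by (auto simp: A Q.mpoly_const_eq_monom intro!: Q.mpoly_monom_closed Q.Icarr)
  interpret IQ: ideal "Idl\<^bsub>A\<^esub> (mpoly_const R ` Q)" A by (rule \<Phi>.R.genideal_ideal[OF constQ])
  interpret Jt: ideal Jt A unfolding Jt by (rule \<Phi>.R.add_ideals[OF J.is_ideal IQ.is_ideal])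
  \<comment> \<open>The kernel of specialization is an ideal and contains the generators, because Q
    lies in P.\<close>
  have kernel: "?\<phi> \<circ> f = \<zero>\<^bsub>?B\<^esub>" if "f \<in> Idl\<^bsub>A\<^esub> (mpoly_const R ` Q)" for f
  proof -
    have "mpoly_const R q \<in> a_kernel A ?B ((\<circ>) ?\<phi>)" if "q \<in> Q" for q
    proof -
      have "?\<phi> q = \<zero>\<^bsub>?F\<^esub>" using that QP P.residue_map_eq_zero_iff[OF Q.Icarr] by auto
      then have "?\<phi> \<circ> mpoly_const R q = \<zero>\<^bsub>?B\<^esub>"
        unfolding \<phi>.mpoly_map_const by (simp add: mpoly_zero mpoly_const_def)
      then show ?thesis
        unfolding a_kernel_def' using that constQ by blast
    qed
    then have "Idl\<^bsub>A\<^esub> (mpoly_const R ` Q) \<subseteq> a_kernel A ?B ((\<circ>) ?\<phi>)"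
      by (intro \<Phi>.R.genideal_minimal \<Phi>.ring.kernel_is_ideal image_subsetI)
    with that show ?thesis unfolding a_kernel_def' by blast
  qed
  have J_Jt: "J \<subseteq> Jt"
  proof
    fix f assume f: "f \<in> J"
    then have "f \<oplus>\<^bsub>A\<^esub> \<zero>\<^bsub>A\<^esub> \<in> Jt"
      unfolding Jt set_add_def' using additive_subgroup.zero_closed[OF IQ.is_additive_subgroup] by blast
    then show "f \<in> Jt" using J.Icarr[OF f] by simp
  qed
  have image: "specialize R P ` J \<subseteq> carrier ?B"
    unfolding spec using J.Icarr \<Phi>.hom_closed by blast
  interpret SJ: ideal "specialize_ideal R P J" ?B
    unfolding specialize_ideal_def using image by (rule \<Phi>.S.genideal_ideal)
  \<comment> \<open>Enlarging J by Q does not enlarge the specialized ideal, so the elements of G,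
    taken from \<open>Jt\<close>, specialize into it.\<close>
  have Jt_spec: "?\<phi> \<circ> f \<in> specialize_ideal R P J" if f: "f \<in> Jt" for f
  proof -
    obtain j q where jq: "j \<in> J" "q \<in> Idl\<^bsub>A\<^esub> (mpoly_const R ` Q)" "f = j \<oplus>\<^bsub>A\<^esub> q"
      using f unfolding Jt by (rule set_add_memE)
    then have "?\<phi> \<circ> f = ?\<phi> \<circ> j"
      using J.Icarr[of j] IQ.Icarr[of q] kernel[of q] by simp
    moreover have "?\<phi> \<circ> j \<in> specialize R P ` J" using jq by (simp add: spec)
    ultimately show ?thesis
      using \<Phi>.S.genideal_self[OF image] unfolding specialize_ideal_def by auto
  qed
  have G: "groebner_basis A (mpoly_supp2 K) (block_order prec prec0) G Jt"
    using assms(11) by (simp add: minimal_groebner_basis_def)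
  then have finG: "finite G" and G_Jt: "G \<subseteq> Jt - {\<zero>\<^bsub>A\<^esub>}" by (simp_all add: groebner_basis_def)
  have lc_closed: "?lc g \<in> carrier R" if "g \<in> G" for g
    using that G_Jt Jt.Icarr coeff_closed by (auto simp: lead_coef_def)
  have lc_notin: "?lc g \<notin> P" if g: "g \<in> Gc" for g
  proof
    assume "?lc g \<in> P"
    then have "h \<in> P"
      unfolding h using g lc_closed finG by (intro P.finprod_in_ideal[OF Q.cring_axioms]) (auto simp: Gc)
    then have "PIdl\<^bsub>R\<^esub> h \<subseteq> P" by (intro Q.cgenideal_minimal P.is_ideal)
    then show False using assms(14) P.primeideal_axioms by (simp add: zero_locus_def)
  qed
  have \<phi>lc: "?\<phi> (?lc g) \<noteq> \<zero>\<^bsub>?F\<^esub>" if "g \<in> Gc" for g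
    using that lc_notin lc_closed P.residue_map_eq_zero_iff by (auto simp: Gc)
  have le_spec: "?leF (?\<phi> \<circ> g) = ?le g" if g: "g \<in> Gc" for g
  proof (rule max_exp_eqI[OF assms(6)])
    have gA: "g \<in> carrier A" "g \<noteq> \<zero>\<^bsub>A\<^esub>" using g G_Jt Jt.Icarr by (auto simp: Gc)
    show "?le g \<in> mpoly_supp ?F (?\<phi> \<circ> g)"
      using \<phi>lc[OF g] by (simp add: mpoly_supp_def lead_coef_def)
    fix \<beta> assume "\<beta> \<in> mpoly_supp ?F (?\<phi> \<circ> g)" "\<beta> \<noteq> ?le g"
    then show "prec \<beta> (?le g)"
      by (intro lead_exp_max[OF assms(6) gA[unfolded A]]) (auto simp: mpoly_supp_def)
  qed
  have spec_nz: "?\<phi> \<circ> g \<noteq> \<zero>\<^bsub>?B\<^esub>" if g: "g \<in> Gc" for g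
    using \<phi>lc[OF g] by (auto simp: lead_coef_def mpoly_zero fun_eq_iff)
  have dichotomy: "?\<phi> (?lc g) \<noteq> \<zero>\<^bsub>?F\<^esub> \<or>
      (\<exists>q\<in>carrier R. ?\<phi> q = \<zero>\<^bsub>?F\<^esub> \<and> g = mpoly_const R q)" if g: "g \<in> G" for g
  proof (cases "g \<in> Gc")
    case False
    then obtain q where "q \<in> Q" "g = mpoly_const R q" using g by (auto simp: Gc)
    then show ?thesis using QP P.residue_map_eq_zero_iff[of q] Q.Icarr[of q] by auto
  qed (simp add: \<phi>lc)
  have "{?leF X | X. X \<in> specialize_ideal R P J - {\<zero>\<^bsub>?B\<^esub>}} =
      (\<Union>g\<in>Gc. {?le g + \<beta> | \<beta>. True})"
  proof (intro equalityI subsetI)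
    fix \<alpha> assume "\<alpha> \<in> {?leF X | X. X \<in> specialize_ideal R P J - {\<zero>\<^bsub>?B\<^esub>}}"
    then obtain X where X: "X \<in> specialize_ideal R P J" "X \<noteq> \<zero>\<^bsub>?B\<^esub>" "\<alpha> = ?leF X" by blast
    obtain s f where s: "s \<in> carrier R - P" and f: "f \<in> J" and XB: "X \<in> carrier ?B"
      and sX: "\<And>\<alpha>. ?\<phi> s \<otimes>\<^bsub>?F\<^esub> X \<alpha> = ?\<phi> (f \<alpha>)"
      using P.specialize_ideal_denominator[OF J.is_ideal[unfolded A] X(1)] by metis
    have \<phi>s: "?\<phi> s \<noteq> \<zero>\<^bsub>?F\<^esub>" "?\<phi> s \<in> carrier ?F" using s P.residue_map_eq_zero_iff[of s] by auto
    \<comment> \<open>X and the specialization of f differ by a nonzero scalar of a domain, so they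
      have the same leading exponent.\<close>
    have supp: "mpoly_supp ?F X = mpoly_supp ?F (?\<phi> \<circ> f)"
      using \<phi>s mpoly_coeff_closed[OF XB] by (simp add: mpoly_supp_def F.integral_iff flip: sX)
    have "?\<phi> \<circ> f \<noteq> \<zero>\<^bsub>?B\<^esub>"
    proof
      assume "?\<phi> \<circ> f = \<zero>\<^bsub>?B\<^esub>"
      then have "mpoly_supp ?F X = {}" unfolding supp by (simp add: mpoly_supp_def mpoly_zero)
      with X(2) show False using mpoly_supp_nonempty by blast
    qed
    then have "\<exists>g\<in>G. ?\<phi> (?lc g) \<noteq> \<zero>\<^bsub>?F\<^esub> \<and> (\<exists>\<beta>. ?leF (?\<phi> \<circ> f) = ?le g + \<beta>)"
      using f J_Jt
      by (intro groebner_descent[OF assms(1) R A assms(4-7) F.domain_axioms P.residue_map_hom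
            Jt.is_ideal G] dichotomy) auto
    then obtain g \<beta> where g: "g \<in> G" "?\<phi> (?lc g) \<noteq> \<zero>\<^bsub>?F\<^esub>" and "?leF (?\<phi> \<circ> f) = ?le g + \<beta>"
      by blast
    then have \<alpha>: "\<alpha> = ?le g + \<beta>" using X(3) supp by simp
    \<comment> \<open>The descent returns some g in G with surviving leading coefficient; a constant
      from Q would vanish entirely modulo P, so g belongs to \<open>Gc\<close>.\<close>
    have "g \<notin> mpoly_const R ` Q"
    proof
      assume "g \<in> mpoly_const R ` Q"
      then obtain q where q: "q \<in> Q" "g = mpoly_const R q" by blast
      then have "?\<phi> (g \<gamma>) = \<zero>\<^bsub>?F\<^esub>" for \<gamma>
        using QP P.residue_map_eq_zero_iff[of q] Q.Icarr[of q] by (auto simp: mpoly_const_def)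
      then show False using g(2) by (simp add: lead_coef_def)
    qed
    then show "\<alpha> \<in> (\<Union>g\<in>Gc. {?le g + \<beta> | \<beta>. True})" using g \<alpha> by (auto simp: Gc)
  next
    fix \<alpha> assume "\<alpha> \<in> (\<Union>g\<in>Gc. {?le g + \<beta> | \<beta>. True})"
    then obtain g \<beta> where g: "g \<in> Gc" and \<alpha>: "\<alpha> = ?le g + \<beta>" by blast
    \<comment> \<open>The converse inclusion: a monic monomial multiple of a specialized basis
      element realizes every prescribed exponent.\<close>
    let ?X = "mpoly_monom ?F \<beta> \<one>\<^bsub>?F\<^esub> \<otimes>\<^bsub>?B\<^esub> (?\<phi> \<circ> g)"
    have \<phi>g: "?\<phi> \<circ> g \<in> specialize_ideal R P J" using g G_Jt Jt_spec by (auto simp: Gc)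
    then have \<phi>gB: "?\<phi> \<circ> g \<in> carrier ?B" by (rule SJ.Icarr)
    have X: "?X \<in> specialize_ideal R P J"
      using \<phi>g by (intro SJ.I_l_closed F.mpoly_monom_closed) auto
    have "?X (\<beta> + ?le g) = ?\<phi> (?lc g)"
      using F.mpoly_monom_mult[OF \<phi>gB F.one_closed] mpoly_coeff_closed[OF \<phi>gB, of "?le g"]
      by (simp add: lead_coef_def)
    then have nz: "?X \<alpha> \<noteq> \<zero>\<^bsub>?F\<^esub>" using \<phi>lc[OF g] by (simp add: \<alpha> add.commute)
    have "?leF ?X = \<alpha>"
    proof (rule max_exp_eqI[OF assms(6)])
      show "\<alpha> \<in> mpoly_supp ?F ?X" using nz by (simp add: mpoly_supp_def)
      fix \<gamma> assume "\<gamma> \<in> mpoly_supp ?F ?X" "\<gamma> \<noteq> \<alpha>"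
      then have "?X \<gamma> \<noteq> \<zero>\<^bsub>?F\<^esub>" "\<gamma> \<noteq> \<beta> + ?le g"
        by (simp_all add: mpoly_supp_def[of ?F] \<alpha> add.commute)
      then show "prec \<gamma> \<alpha>"
        using F.mpoly_monom_mult_lead[OF assms(6) \<phi>gB spec_nz[OF g] F.one_closed]
        unfolding le_spec[OF g] \<alpha> by (subst add.commute)
    qed
    moreover have "?X \<noteq> \<zero>\<^bsub>?B\<^esub>" using nz by (auto simp: mpoly_zero)
    ultimately show "\<alpha> \<in> {?leF X | X. X \<in> specialize_ideal R P J - {\<zero>\<^bsub>?B\<^esub>}}" using X by blast
  qed
  also have "\<dots> = (\<Union>X\<in>specialize R P ` Gc. {?leF X + \<beta> | \<beta>. True})"
    by (simp add: spec le_spec)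
  finally have "{?leF X | X. X \<in> specialize_ideal R P J - {\<zero>\<^bsub>?B\<^esub>}} =
      (\<Union>X\<in>specialize R P ` Gc. {?leF X + \<beta> | \<beta>. True})" .
  moreover have "specialize R P ` Gc \<subseteq> specialize_ideal R P J - {\<zero>\<^bsub>?B\<^esub>}"
    using G_Jt Jt_spec spec_nz by (auto simp: spec Gc)
  moreover have "finite (specialize R P ` Gc)" using finG by (simp add: Gc)
  ultimately show ?thesis unfolding groebner_basis_def by blast
qed

end
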